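(* Let $\alpha>0$ and let $f$ be a positive concave function on $(0,\infty)$ that is regularly varying at zero with index less than $1$. Let $\widetilde Z_{\alpha,f}=\{\widetilde Z_{\alpha,f}(t),t>0\}$ be the $\alpha$-permanental process, with continuous sample paths on $(0,\infty)$, with kernel $$\widetilde u_f(s,t)=s\wedge t+f(t),\qquad s,t>0.$$ Then, for a coupling of $\widetilde Z_{\alpha,f}$ with a gamma random variable $\xi_{\alpha,1}$ with shape $\alpha$ and scale $1$ for which $\lim_{t\to0}\widetilde Z_{\alpha,f}(t)/f(t)=\xi_{\alpha,1}$ a.s. (such a coupling exists), $$\limsup_{t\to0}\frac{|\widetilde Z_{\alpha,f}^{1/2}(t)-(f(t)\xi_{\alpha,1})^{1/2}|}{(t\log\log1/t)^{1/2}}\le1\qquad a.s.$$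
   Context: For $\alpha>0$, a random vector $(X_1,\dots,X_n)$ with nonnegative components is $\alpha$-permanental with kernel $U$ (a real $n\times n$ matrix) if $E\big(e^{-\sum_{i=1}^n s_iX_i}\big)=|I+US|^{-\alpha}$ for every diagonal matrix $S$ with positive diagonal entries $s_1,\dots,s_n$, where $|\cdot|$ denotes the determinant. A stochastic process $\{X_\alpha(t),t\in\mathcal T\}$ is an $\alpha$-permanental process with kernel $\{u(s,t),s,t\in\mathcal T\}$ if for all $t_1,\dots,t_n\in\mathcal T$ the vector $(X_\alpha(t_1),\dots,X_\alpha(t_n))$ is $\alpha$-permanental with kernel $\{u(t_i,t_j)\}_{i,j=1}^n$. For every positive concave $f$ on $(0,\infty)$, $\widetilde u_f$ is the kernel of an $\alpha$-permanental process for all $\alpha>0$. The gamma random variable $\xi_{\alpha,1}$ has density $x^{\alpha-1}e^{-x}/\Gamma(\alpha)$ on $x>0$. A coupling means that the process and the random variable are realized on a common probability space with their given laws. *)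

theory Defs
  imports "HOL-Probability.Probability" "Jordan_Normal_Form.Determinant"
begin

(* The determinant and the vectors and matrices of arbitrary size n are those of
   Jordan_Normal_Form; HOL-Analysis has another constant called det, indexed by types.
   No positivity of the determinant is demanded below: since 0 powr a = 0, the identity makes
   det (1 + U S) nonzero for all admissible S, and as S tends to 0 it tends to 1, so it is
   positive throughout and the real power is the usual one. *)
definition permanental_vector ::
  "'a measure \<Rightarrow> real \<Rightarrow> nat \<Rightarrow> (nat \<Rightarrow> 'a \<Rightarrow> real) \<Rightarrow> real mat \<Rightarrow> bool" where
  "permanental_vector M \<alpha> n X U \<longleftrightarrow>
     U \<in> carrier_mat n n \<and>
     (\<forall>i<n. X i \<in> borel_measurable M \<and> (AE \<omega> in M. 0 \<le> X i \<omega>)) \<and>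
     (\<forall>S \<in> carrier_mat n n. diagonal_mat S \<and> (\<forall>i<n. 0 < S $$ (i, i)) \<longrightarrow>
        (\<integral>\<omega>. exp (- (\<Sum>i<n. S $$ (i, i) * X i \<omega>)) \<partial>M)
          = Determinant.det (1\<^sub>m n + U * S) powr (- \<alpha>))"

definition permanental_process ::
  "'a measure \<Rightarrow> real \<Rightarrow> 't set \<Rightarrow> ('t \<Rightarrow> 't \<Rightarrow> real) \<Rightarrow> ('t \<Rightarrow> 'a \<Rightarrow> real) \<Rightarrow> bool" where
  "permanental_process M \<alpha> T u Z \<longleftrightarrow>
     (\<forall>n t. (\<forall>i<n. t i \<in> T) \<longrightarrow>
        permanental_vector M \<alpha> n (\<lambda>i. Z (t i)) (mat n n (\<lambda>(i, j). u (t i) (t j))))"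

definition u_tilde :: "(real \<Rightarrow> real) \<Rightarrow> real \<Rightarrow> real \<Rightarrow> real" where
  "u_tilde f s t = min s t + f t"

definition regularly_varying_at_zero :: "(real \<Rightarrow> real) \<Rightarrow> real \<Rightarrow> bool" where
  "regularly_varying_at_zero f \<rho> \<longleftrightarrow>
     (\<exists>a>0. set_borel_measurable borel {0<..<a} f \<and> (\<forall>t\<in>{0<..<a}. 0 < f t)) \<and>
     (\<forall>c>0. ((\<lambda>t. f (c * t) / f t) \<longlongrightarrow> c powr \<rho>) (at_right 0))"

definition gamma_density :: "real \<Rightarrow> real \<Rightarrow> real" where
  "gamma_density \<alpha> x = (if 0 < x then x powr (\<alpha> - 1) * exp (- x) / Gamma \<alpha> else 0)"

(* A coupling of Z with a gamma variable: Z and \<xi> live on the same probability space M. *)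
definition gamma_coupling ::
  "'a measure \<Rightarrow> real \<Rightarrow> (real \<Rightarrow> real) \<Rightarrow> (real \<Rightarrow> 'a \<Rightarrow> real) \<Rightarrow> ('a \<Rightarrow> real) \<Rightarrow> bool" where
  "gamma_coupling M \<alpha> f Z \<xi> \<longleftrightarrow>
     distributed M lborel \<xi> (\<lambda>x. ennreal (gamma_density \<alpha> x)) \<and>
     (AE \<omega> in M. ((\<lambda>t. Z t \<omega> / f t) \<longlongrightarrow> \<xi> \<omega>) (at_right 0))"

end

theory Submission
  imports Defs "HOL-Real_Asymp.Real_Asymp"
begin

text \<open>
  Write \<open>G t = Z t / f t\<close>. Everything rests on the Laplace transform of a pair \<open>(Z s, Z t)\<close>
  with \<open>s < t\<close>, a power \<open>- \<alpha>\<close> of a polynomial that is affine in each of the two variables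
  (\<open>laplace_two\<close>). A positive variable whose transform is \<open>(A + B s) powr (- \<alpha>)\<close> is a scaled gamma
  variable, also under a weighted measure, so the formula persists for negative arguments as long as
  \<open>A + B s\<close> stays positive (\<open>laplace_extension\<close>). This turns the transforms into exponential
  moments with signs, and these drive the proof in two ways.

  Increments. The variable \<open>G t - G s\<close> has exponential tails on the scale \<open>sqrt ((t - s) / f t)\<close>
  (\<open>increment_exp_abs_bound\<close>). Chaining over dyadic points gives, almost surely, a bound for the
  oscillation of \<open>G\<close> on each of countably many intervals, with one random constant and a
  logarithmic loss in the number of the interval (\<open>oscillation_bound\<close>). Since \<open>f\<close> is regularly
  varying with index less than 1, the ratio \<open>t / f t\<close> is bounded by a positive power of \<open>t\<close>; hence
  the oscillations are summable and \<open>G\<close> converges at 0. The limit \<open>\<xi>\<close> has Laplace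
  transform \<open>(1 + a) powr (- \<alpha>)\<close>, and is therefore a gamma variable (\<open>coupling_exists\<close>).

  Deviation from the limit. Letting \<open>s\<close> tend to 0 in the transform of \<open>(G s, Z t)\<close> yields the
  transform of \<open>(\<xi>, Z t)\<close>, and from it the identity (\<open>centred_exp_moment\<close>)
  that \<open>exp (\<theta> * Z t - \<theta> * f t / (1 - t * \<theta>) * \<xi>)\<close> has expectation \<open>(1 - t * \<theta>) powr (- \<alpha>)\<close> when \<open>t * \<theta> < 1\<close>.
  Expanding in \<open>t * \<theta>\<close>, it says that given \<open>\<xi>\<close> the difference \<open>Z t - f t * \<xi>\<close>
  has the exponential moments of a Gaussian variable of variance \<open>2 * t * f t * \<xi>\<close>, up to lower
  order. Along \<open>t = exp (- (n powr \<beta>))\<close> with \<open>\<beta> < 1\<close> one has \<open>ln (ln (1 / t)) = \<beta> * ln n\<close>, and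
  the Gaussian bound at the probability level \<open>n powr (- 1 / \<beta>)\<close>, which is summable, gives
  \<open>\<bar>Z t - f t * \<xi>\<bar> \<le> 2 * (1 + o(1)) / \<beta> * sqrt (t * f t * \<xi> * ln (ln (1 / t)))\<close>.
  Dividing by \<open>sqrt (Z t) + sqrt (f t * \<xi>)\<close>, which is asymptotic to \<open>2 * sqrt (f t * \<xi>)\<close>,
  produces the constant \<open>1 / \<beta>\<close>.

  The optimal \<open>\<theta>\<close> is proportional to \<open>1 / sqrt \<xi>\<close> and thus random. It is replaced by a
  deterministic one, with a rational \<open>x\<close> in place of \<open>\<xi>\<close>; as there are countably many \<open>x\<close>, the
  exceptional sets can be discarded together and \<open>x\<close> may afterwards be chosen close to the value of
  \<open>\<xi>\<close> (\<open>mesh_deviation\<close>). Because \<open>\<beta> < 1\<close>, consecutive points of the mesh have ratio tending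
  to 1 at a rate that beats the logarithmic loss in the oscillation bound, so the estimate extends to all
  small \<open>t\<close> (\<open>lil_parametrized\<close>). Finally \<open>\<beta>\<close> tends to 1.
\<close>

section \<open>Laplace transforms and the gamma law\<close>

text \<open>The exponential series may be integrated term by term because the distribution lives on
  a bounded interval.\<close>
lemma char_eq_suminf_moments:
  assumes N: "real_distribution N" and bd: "AE x in N. \<bar>x\<bar> \<le> 1"
  shows "char N t = (\<Sum>k. (\<i> * complex_of_real t) ^ k / fact k * complex_of_real (\<integral>x. x ^ k \<partial>N))"
proof -
  interpret real_distribution N by (rule N)
  let ?c = "\<lambda>k. (\<i> * complex_of_real t) ^ k / fact k"
  let ?f = "\<lambda>k x. ?c k * complex_of_real (x ^ k)"
  have bdk: "AE x in N. \<bar>x ^ k\<bar> \<le> 1" for k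
    using bd by eventually_elim (simp add: power_abs power_le_one)
  have int: "integrable N (\<lambda>x. x ^ k)" for k
    by (rule integrable_const_bound[where B=1]) (use bdk[of k] in auto)
  have intf: "integrable N (?f k)" for k
    by (intro integrable_mult_right integrable_of_real int)
  have norm_c: "norm (?c k) = \<bar>t\<bar> ^ k / fact k" for k
    by (simp add: norm_divide norm_power norm_mult)
  have le: "AE x in N. norm (?f k x) \<le> \<bar>t\<bar> ^ k / fact k" for k
    using bdk[of k]
  proof eventually_elim
    case (elim x)
    have "norm (?f k x) = (\<bar>t\<bar> ^ k / fact k) * \<bar>x ^ k\<bar>"
      by (simp only: norm_mult norm_c norm_of_real)
    also have "\<dots> \<le> (\<bar>t\<bar> ^ k / fact k) * 1"
      by (rule mult_left_mono[OF elim]) simp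
    finally show ?case by simp
  qed
  have sumt: "summable (\<lambda>k. \<bar>t\<bar> ^ k / fact k)"
    using summable_exp[of "\<bar>t\<bar>"] by (simp add: field_simps)
  have le_int: "(\<integral>x. norm (?f k x) \<partial>N) \<le> \<bar>t\<bar> ^ k / fact k" for k
    using integral_mono_AE[of N "\<lambda>x. norm (?f k x)" "\<lambda>_. \<bar>t\<bar> ^ k / fact k"]
      integrable_norm[OF intf[of k]] le[of k] prob_space by simp
  have "(\<integral>x. (\<Sum>k. ?f k x) \<partial>N) = (\<Sum>k. \<integral>x. ?f k x \<partial>N)"
  proof (rule integral_suminf[OF intf])
    have "AE x in N. \<forall>k. norm (?f k x) \<le> \<bar>t\<bar> ^ k / fact k"
      using le by (simp add: AE_all_countable)
    then show "AE x in N. summable (\<lambda>k. norm (?f k x))"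
      by eventually_elim (rule summable_comparison_test[OF _ sumt], auto)
    show "summable (\<lambda>k. \<integral>x. norm (?f k x) \<partial>N)"
      by (rule summable_comparison_test[OF _ sumt])
         (use le_int in \<open>auto intro!: exI[of _ 0] simp del: of_real_power\<close>)
  qed
  moreover have "(\<Sum>k. ?f k x) = iexp (t * x)" for x
  proof -
    have "(\<lambda>k. (\<i> * complex_of_real (t * x)) ^ k /\<^sub>R fact k) sums exp (\<i> * complex_of_real (t * x))"
      by (rule exp_converges)
    moreover have "(\<i> * complex_of_real (t * x)) ^ k /\<^sub>R fact k = ?f k x" for k
      by (simp add: scaleR_conv_of_real power_mult_distrib field_simps)
    ultimately have "(\<lambda>k. ?f k x) sums iexp (t * x)" by (simp only:)
    then show ?thesis by (rule sums_unique[symmetric])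
  qed
  moreover have "(\<integral>x. ?f k x \<partial>N) = ?c k * complex_of_real (\<integral>x. x ^ k \<partial>N)" for k
    by (subst integral_mult_right_zero) (simp only: integral_complex_of_real)
  ultimately show ?thesis
    unfolding char_def by (simp only:)
qed

lemma distribution_eq_of_moments_eq:
  assumes "real_distribution M1" "real_distribution M2"
    and "AE x in M1. \<bar>x\<bar> \<le> 1" "AE x in M2. \<bar>x\<bar> \<le> 1"
    and "\<And>k. (\<integral>x. x ^ k \<partial>M1) = (\<integral>x. x ^ k \<partial>M2)"
  shows "M1 = M2"
  by (rule Levy_uniqueness[OF assms(1,2)])
     (simp add: fun_eq_iff char_eq_suminf_moments[OF assms(1,3)] char_eq_suminf_moments[OF assms(2,4)] assms(5))

text \<open>The Laplace transform at the integers lists the moments of \<open>exp (- X)\<close>, a variable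
  with values in the unit interval, where moments determine the law; the logarithm recovers \<open>X\<close>.\<close>
lemma distr_eq_of_laplace_eq:
  assumes M1: "prob_space M1" and M2: "prob_space M2"
    and X1 [measurable]: "X1 \<in> borel_measurable M1" and X2 [measurable]: "X2 \<in> borel_measurable M2"
    and p1: "AE \<omega> in M1. 0 \<le> X1 \<omega>" and p2: "AE \<omega> in M2. 0 \<le> X2 \<omega>"
    and eq: "\<And>k::nat. (\<integral>\<^sup>+\<omega>. exp (- real k * X1 \<omega>) \<partial>M1) = (\<integral>\<^sup>+\<omega>. exp (- real k * X2 \<omega>) \<partial>M2)"
  shows "distr M1 borel X1 = distr M2 borel X2"
proof -
  interpret M1: prob_space M1 by (rule M1)
  interpret M2: prob_space M2 by (rule M2)
  let ?Y1 = "\<lambda>\<omega>. exp (- X1 \<omega>)" and ?Y2 = "\<lambda>\<omega>. exp (- X2 \<omega>)"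
  have mom: "(\<integral>x. x ^ k \<partial>distr N borel (\<lambda>\<omega>. exp (- X \<omega>))) = enn2real (\<integral>\<^sup>+\<omega>. exp (- real k * X \<omega>) \<partial>N)"
    if [measurable]: "X \<in> borel_measurable N" for X :: "'c \<Rightarrow> real" and N k
    by (simp add: integral_distr integral_eq_nn_integral exp_of_nat_mult[symmetric])
  have "distr M1 borel ?Y1 = distr M2 borel ?Y2"
  proof (rule distribution_eq_of_moments_eq)
    show "real_distribution (distr M1 borel ?Y1)" "real_distribution (distr M2 borel ?Y2)"
      by (simp_all add: M1.real_distribution_distr M2.real_distribution_distr)
    show "AE x in distr M1 borel ?Y1. \<bar>x\<bar> \<le> 1" "AE x in distr M2 borel ?Y2. \<bar>x\<bar> \<le> 1"
      using p1 p2 by (simp_all add: AE_distr_iff)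
    show "(\<integral>x. x ^ k \<partial>distr M1 borel ?Y1) = (\<integral>x. x ^ k \<partial>distr M2 borel ?Y2)" for k
      by (simp only: mom[OF X1] mom[OF X2] eq)
  qed
  then have "distr (distr M1 borel ?Y1) borel (\<lambda>y. - ln y) = distr (distr M2 borel ?Y2) borel (\<lambda>y. - ln y)"
    by simp
  then show ?thesis
    by (simp add: distr_distr comp_def)
qed

lemma borel_measurable_gamma_density [measurable]: "gamma_density \<alpha> \<in> borel_measurable borel"
  unfolding gamma_density_def by measurable

text \<open>Substituting \<open>(1 + s) * x\<close> in Euler's integral for \<open>Gamma \<alpha>\<close>. The range includes
  negative \<open>s\<close>, which is what makes exponential moments accessible.\<close>
lemma nn_integral_gamma_density_exp:
  assumes \<alpha>: "0 < \<alpha>" and s: "-1 < s"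
  shows "(\<integral>\<^sup>+x. ennreal (gamma_density \<alpha> x) * ennreal (exp (- s * x)) \<partial>lborel) = ennreal ((1 + s) powr (- \<alpha>))"
proof -
  let ?g = "\<lambda>t::real. ennreal (indicator {0..} t * t powr (\<alpha> - 1) / exp t)"
  have G: "0 < Gamma \<alpha>" using \<alpha> by (rule Gamma_real_pos)
  then have G0: "Gamma \<alpha> \<noteq> 0" by (rule less_imp_neq[symmetric])
  have "ennreal (Gamma \<alpha>) = (\<integral>\<^sup>+t. ?g t \<partial>lborel)"
    by (rule Gamma_conv_nn_integral_real[OF \<alpha>])
  also have "\<dots> = ennreal \<bar>1 + s\<bar> * (\<integral>\<^sup>+x. ?g (0 + (1 + s) * x) \<partial>lborel)"
    by (rule nn_integral_real_affine) (use s in auto)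
  also have "\<dots> = (\<integral>\<^sup>+x. ennreal (Gamma \<alpha> * (1 + s) powr \<alpha>) * (ennreal (gamma_density \<alpha> x) * ennreal (exp (- s * x))) \<partial>lborel)"
    using s
  proof (subst nn_integral_cmult[symmetric], simp, intro nn_integral_cong, goal_cases)
    case (1 x)
    show ?case
    proof (cases "0 < x")
      case True
      have "(1 + s) * (((1 + s) * x) powr (\<alpha> - 1) / exp ((1 + s) * x))
          = Gamma \<alpha> * (1 + s) powr \<alpha> * (x powr (\<alpha> - 1) * exp (- x) / Gamma \<alpha> * exp (- s * x))"
      proof -
        have p: "(1 + s) * ((1 + s) * x) powr (\<alpha> - 1) = (1 + s) powr \<alpha> * x powr (\<alpha> - 1)"
          using True s by (simp add: powr_mult powr_diff)
        have "exp ((1 + s) * x) = exp x * exp (s * x)"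
          by (simp add: exp_add[symmetric] algebra_simps)
        then have "(1 + s) * (((1 + s) * x) powr (\<alpha> - 1) / exp ((1 + s) * x))
            = (1 + s) powr \<alpha> * x powr (\<alpha> - 1) / (exp x * exp (s * x))"
          by (simp only: times_divide_eq_right p)
        then show ?thesis
          using G0 by (simp add: exp_minus divide_simps)
      qed
      then show ?thesis
        using True s G G0 \<alpha> by (simp add: gamma_density_def ennreal_mult[symmetric])
    next
      case False
      then show ?thesis
        using s by (auto simp: gamma_density_def indicator_def zero_le_mult_iff not_less)
    qed
  qed
  also have "\<dots> = ennreal (Gamma \<alpha> * (1 + s) powr \<alpha>) * (\<integral>\<^sup>+x. ennreal (gamma_density \<alpha> x) * ennreal (exp (- s * x)) \<partial>lborel)"
    (is "_ = _ * ?I") by (rule nn_integral_cmult) simp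
  finally have *: "ennreal (Gamma \<alpha>) = ennreal (Gamma \<alpha> * (1 + s) powr \<alpha>) * ?I" .
  have "ennreal ((1 + s) powr (- \<alpha>)) = ennreal ((1 + s) powr (- \<alpha>) / Gamma \<alpha>) * ennreal (Gamma \<alpha>)"
    using G s by (simp add: ennreal_mult[symmetric])
  also have "\<dots> = ennreal ((1 + s) powr (- \<alpha>) / Gamma \<alpha>) * (ennreal (Gamma \<alpha> * (1 + s) powr \<alpha>) * ?I)"
    by (simp only: *)
  also have "\<dots> = ennreal ((1 + s) powr (- \<alpha>) / Gamma \<alpha> * (Gamma \<alpha> * (1 + s) powr \<alpha>)) * ?I"
  proof -
    have "ennreal ((1 + s) powr (- \<alpha>) / Gamma \<alpha> * (Gamma \<alpha> * (1 + s) powr \<alpha>))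
        = ennreal ((1 + s) powr (- \<alpha>) / Gamma \<alpha>) * ennreal (Gamma \<alpha> * (1 + s) powr \<alpha>)"
      by (rule ennreal_mult) (use G in auto)
    then show ?thesis by (simp only: mult.assoc)
  qed
  also have "(1 + s) powr (- \<alpha>) / Gamma \<alpha> * (Gamma \<alpha> * (1 + s) powr \<alpha>) = 1"
    using G0 s by (simp add: powr_minus)
  finally show ?thesis by simp
qed

lemma distributed_gamma_of_laplace:
  assumes N: "prob_space N" and \<alpha>: "0 < \<alpha>"
    and X [measurable]: "X \<in> borel_measurable N" and pos: "AE \<omega> in N. 0 \<le> X \<omega>"
    and lap: "\<And>s. 0 \<le> s \<Longrightarrow> (\<integral>\<^sup>+\<omega>. exp (- s * X \<omega>) \<partial>N) = ennreal ((1 + s) powr (- \<alpha>))"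
  shows "distributed N lborel X (\<lambda>x. ennreal (gamma_density \<alpha> x))"
proof -
  let ?\<gamma> = "density lborel (\<lambda>x. ennreal (gamma_density \<alpha> x))"
  have "prob_space ?\<gamma>"
    using nn_integral_gamma_density_exp[OF \<alpha>, of 0] by (intro prob_spaceI) (simp add: emeasure_density)
  moreover have "AE x in ?\<gamma>. 0 \<le> x"
    by (subst AE_density) (auto simp: gamma_density_def)
  ultimately have "distr N borel X = distr ?\<gamma> borel (\<lambda>x. x)"
    by (intro distr_eq_of_laplace_eq N pos X)
       (auto simp: lap[simplified] nn_integral_density nn_integral_gamma_density_exp[OF \<alpha>, simplified])
  also have "\<dots> = ?\<gamma>"
    by (rule distr_id2) simp
  finally have "distr N borel X = ?\<gamma>" .
  moreover have "distr N lborel X = distr N borel X"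
    by (rule distr_cong) simp_all
  ultimately show ?thesis
    by (simp add: distributed_def)
qed

text \<open>Under the measure with density proportional to \<open>w\<close>, the variable \<open>A / B * X\<close> has the
  Laplace transform of a gamma variable on the positive half-line, hence is one, and the transform of the
  gamma law is known beyond that half-line. For the joint transforms below, \<open>w\<close> is the exponential
  of the other variable, so that signs can be relaxed one variable at a time.\<close>
lemma laplace_extension:
  fixes w X :: "'b \<Rightarrow> real"
  assumes \<alpha>: "0 < \<alpha>" and A: "0 < A" and B: "0 < B"
    and [measurable]: "w \<in> borel_measurable M" "X \<in> borel_measurable M"
    and w: "\<And>\<omega>. 0 \<le> w \<omega>" and pos: "AE \<omega> in M. 0 \<le> X \<omega>"
    and lap: "\<And>s. 0 \<le> s \<Longrightarrow> (\<integral>\<^sup>+\<omega>. w \<omega> * exp (- s * X \<omega>) \<partial>M) = ennreal ((A + B * s) powr (- \<alpha>))"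
    and s: "0 < A + B * s"
  shows "(\<integral>\<^sup>+\<omega>. w \<omega> * exp (- s * X \<omega>) \<partial>M) = ennreal ((A + B * s) powr (- \<alpha>))"
proof -
  let ?N = "density M (\<lambda>\<omega>. ennreal (w \<omega> * A powr \<alpha>))"
  let ?Y = "\<lambda>\<omega>. A / B * X \<omega>"
  have dens: "(\<integral>\<^sup>+\<omega>. exp (- r * ?Y \<omega>) \<partial>?N)
      = ennreal (A powr \<alpha>) * (\<integral>\<^sup>+\<omega>. w \<omega> * exp (- (A * r / B) * X \<omega>) \<partial>M)" for r
    using w by (subst nn_integral_density)
      (auto simp: nn_integral_cmult[symmetric] ennreal_mult[symmetric] ac_simps intro!: nn_integral_cong)
  have scale: "A powr \<alpha> * (A + A * r) powr (- \<alpha>) = (1 + r) powr (- \<alpha>)" if "-1 < r" for r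
  proof -
    have "A + A * r = A * (1 + r)" by (simp add: algebra_simps)
    then show ?thesis using A that by (simp add: powr_mult powr_minus)
  qed
  have lapN: "(\<integral>\<^sup>+\<omega>. exp (- r * ?Y \<omega>) \<partial>?N) = ennreal ((1 + r) powr (- \<alpha>))" if "0 \<le> r" for r
    using that A B lap[of "A * r / B"] scale[of r] unfolding dens
    by (simp add: ennreal_mult'[symmetric])
  have gam: "distributed ?N lborel ?Y (\<lambda>x. ennreal (gamma_density \<alpha> x))"
  proof (rule distributed_gamma_of_laplace[OF _ \<alpha>])
    show "prob_space ?N"
      using lapN[of 0] by (intro prob_spaceI) simp
    show "AE \<omega> in ?N. 0 \<le> ?Y \<omega>"
      using pos A B by (subst AE_density) (auto elim!: eventually_mono)
  qed (use lapN in auto)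
  define r where "r = B * s / A"
  have r: "-1 < r" and s_r: "s = A * r / B" using s A B by (simp_all add: r_def field_simps)
  have "(\<integral>\<^sup>+\<omega>. exp (- r * ?Y \<omega>) \<partial>?N) = (\<integral>\<^sup>+x. ennreal (gamma_density \<alpha> x) * ennreal (exp (- r * x)) \<partial>lborel)"
    using distributed_nn_integral[OF gam, of "\<lambda>x. ennreal (exp (- r * x))"] by simp
  also have "\<dots> = ennreal ((1 + r) powr (- \<alpha>))"
    by (rule nn_integral_gamma_density_exp[OF \<alpha> r])
  finally have "ennreal (A powr \<alpha>) * (\<integral>\<^sup>+\<omega>. w \<omega> * exp (- s * X \<omega>) \<partial>M) = ennreal ((1 + r) powr (- \<alpha>))" (is "_ * ?I = _")
    unfolding dens s_r .
  then have "ennreal (A powr (- \<alpha>)) * ennreal (A powr \<alpha>) * ?I = ennreal (A powr (- \<alpha>)) * ennreal ((1 + r) powr (- \<alpha>))"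
    by (simp add: mult.assoc)
  moreover have "A powr (- \<alpha>) * A powr \<alpha> = 1" using A by (simp add: powr_minus)
  moreover have "A powr (- \<alpha>) * (1 + r) powr (- \<alpha>) = (A + B * s) powr (- \<alpha>)"
    using A B r by (subst powr_mult[symmetric]) (auto simp: s_r algebra_simps)
  ultimately show ?thesis
    by (simp add: ennreal_mult[symmetric])
qed

section \<open>Exponential moments and almost sure bounds\<close>

lemma (in prob_space) nn_integral_exp_uminus:
  assumes [measurable]: "X \<in> borel_measurable M" and "AE \<omega> in M. 0 \<le> X \<omega>"
  shows "(\<integral>\<^sup>+\<omega>. exp (- X \<omega>) \<partial>M) = ennreal (\<integral>\<omega>. exp (- X \<omega>) \<partial>M)"
proof (rule nn_integral_eq_integral)
  show "integrable M (\<lambda>\<omega>. exp (- X \<omega>))"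
    by (rule integrable_const_bound[where B=1]) (use assms in auto)
qed simp

text \<open>A quantitative form of the Borel--Cantelli lemma: the weighted sum of the variables has finite
  expectation, so it is almost surely finite and dominates each of its terms. Applied to
  exponentials, it turns exponential moments into almost sure bounds whose random constant
  enters only through its logarithm.\<close>
lemma (in prob_space) AE_bounded_by_weights:
  fixes Y :: "nat \<Rightarrow> 'a \<Rightarrow> ennreal"
  assumes [measurable]: "\<And>n. Y n \<in> borel_measurable M"
    and bd: "\<And>n. (\<integral>\<^sup>+\<omega>. Y n \<omega> \<partial>M) \<le> ennreal K"
    and w: "\<And>n. 0 \<le> w n" "summable w"
  shows "AE \<omega> in M. \<exists>S\<ge>1. \<forall>n. ennreal (w n) * Y n \<omega> \<le> ennreal S"
proof -
  have "(\<integral>\<^sup>+\<omega>. (\<Sum>n. ennreal (w n) * Y n \<omega>) \<partial>M) = (\<Sum>n. ennreal (w n) * (\<integral>\<^sup>+\<omega>. Y n \<omega> \<partial>M))"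
    by (simp add: nn_integral_suminf nn_integral_cmult)
  also have "\<dots> \<le> (\<Sum>n. ennreal (w n) * ennreal K)"
    by (intro suminf_le mult_left_mono bd) auto
  also have "\<dots> = (\<Sum>n. ennreal (w n)) * ennreal K"
    by (rule ennreal_suminf_multc)
  also have "(\<Sum>n. ennreal (w n)) = ennreal (\<Sum>n. w n)"
    by (rule suminf_ennreal2) (use w in auto)
  also have "\<dots> * ennreal K < \<top>"
    by (simp add: ennreal_mult_less_top)
  finally have "(\<integral>\<^sup>+\<omega>. (\<Sum>n. ennreal (w n) * Y n \<omega>) \<partial>M) \<noteq> \<infinity>"
    by simp
  then have "AE \<omega> in M. (\<Sum>n. ennreal (w n) * Y n \<omega>) \<noteq> \<infinity>"
    by (intro nn_integral_noteq_infinite) auto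
  then show ?thesis
  proof eventually_elim
    case (elim \<omega>)
    define s where "s = (\<Sum>n. ennreal (w n) * Y n \<omega>)"
    have "ennreal (w n) * Y n \<omega> \<le> ennreal (1 + enn2real s)" for n
    proof -
      have "ennreal (w n) * Y n \<omega> \<le> s"
        unfolding s_def using sum_le_suminf[of "\<lambda>n. ennreal (w n) * Y n \<omega>" "{n}"] by simp
      also have "s = ennreal (enn2real s)"
        using elim by (simp add: s_def less_top)
      also have "\<dots> \<le> ennreal (1 + enn2real s)"
        by (intro ennreal_leI) simp
      finally show ?thesis .
    qed
    then show ?case
      by (intro exI[of _ "1 + enn2real s"]) auto
  qed
qed

section \<open>Chaining along dyadic points\<close>

text \<open>A dyadic point of level \<open>K + 1\<close> is one step away from a point of level \<open>K\<close>, so each level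
  costs one increment; continuity reaches the remaining points. An odd point is
  always moved to the right, since the right endpoint is the point of comparison.\<close>
lemma dyadic_chaining:
  fixes g :: "real \<Rightarrow> real"
  assumes pq: "p < q" and cont: "continuous_on {p..q} g"
    and c: "\<And>k. 0 \<le> c k" "summable c"
    and inc: "\<And>k i. i < 2 ^ k \<Longrightarrow>
      \<bar>g (p + (q - p) * real (Suc i) / 2 ^ k) - g (p + (q - p) * real i / 2 ^ k)\<bar> \<le> c k"
    and t: "t \<in> {p..q}"
  shows "\<bar>g t - g q\<bar> \<le> suminf c"
proof -
  define d where "d k i = p + (q - p) * real i / 2 ^ k" for k and i :: nat
  have dyadic: "\<bar>g (d K i) - g q\<bar> \<le> sum c {..K}" if "i \<le> 2 ^ K" for K i
    using that
  proof (induction K arbitrary: i)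
    case 0
    then consider "i = 0" | "i = 1" by (auto simp: le_Suc_eq)
    then show ?case
      using inc[of 0 0] c(1)[of 0] by cases (auto simp: d_def abs_minus_commute)
  next
    case (Suc K)
    have half: "d (Suc K) (2 * j) = d K j" for j
      by (simp add: d_def)
    show ?case
    proof (cases "even i")
      case True
      then obtain j where j: "i = 2 * j" by (elim evenE)
      with Suc.prems have "j \<le> 2 ^ K" by simp
      with Suc.IH[of j] c(1)[of "Suc K"] show ?thesis by (simp add: j half)
    next
      case False
      then obtain j where j: "i = 2 * j + 1" by (elim oddE)
      with Suc.prems have jK: "j < 2 ^ K" by simp
      then have "\<bar>g (d (Suc K) (Suc i)) - g (d (Suc K) i)\<bar> \<le> c (Suc K)"
        unfolding d_def by (intro inc) (simp add: j)
      moreover have "d (Suc K) (Suc i) = d K (Suc j)"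
        using half[of "Suc j"] by (simp add: j)
      moreover have "\<bar>g (d K (Suc j)) - g q\<bar> \<le> sum c {..K}"
        using Suc.IH[of "Suc j"] jK by simp
      ultimately show ?thesis by simp
    qed
  qed
  define i where "i K = nat \<lfloor>(t - p) / (q - p) * 2 ^ K\<rfloor>" for K
  have x: "0 \<le> (t - p) / (q - p)" "(t - p) / (q - p) \<le> 1" using t pq by auto
  have i_le: "real (i K) \<le> (t - p) / (q - p) * 2 ^ K" and i_gt: "(t - p) / (q - p) * 2 ^ K < real (i K) + 1" for K
  proof -
    have "real (nat \<lfloor>y\<rfloor>) \<le> y \<and> y < real (nat \<lfloor>y\<rfloor>) + 1" if "0 \<le> y" for y :: real
      using that by linarith
    moreover have "0 \<le> (t - p) / (q - p) * 2 ^ K" using x(1) by (rule mult_nonneg_nonneg) simp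
    ultimately show "real (i K) \<le> (t - p) / (q - p) * 2 ^ K" "(t - p) / (q - p) * 2 ^ K < real (i K) + 1"
      unfolding i_def by blast+
  qed
  have i2: "i K \<le> 2 ^ K" for K
  proof -
    have "real (i K) \<le> 1 * 2 ^ K"
      using i_le[of K] x(2) by (meson mult_right_mono order_trans zero_le_numeral zero_le_power)
    then show ?thesis by (metis mult_1 of_nat_le_iff of_nat_numeral of_nat_power)
  qed
  have bounds: "d K (i K) \<le> t" "t - (q - p) * (1/2) ^ K \<le> d K (i K)" for K
  proof -
    have "(q - p) * (real (i K) / 2 ^ K) \<le> (q - p) * ((t - p) / (q - p))"
      using i_le[of K] pq by (intro mult_left_mono) (auto simp: pos_divide_le_eq)
    then show "d K (i K) \<le> t" using pq by (simp add: d_def)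
    have "(q - p) * ((t - p) / (q - p)) \<le> (q - p) * ((real (i K) + 1) / 2 ^ K)"
      using i_gt[of K] pq by (intro mult_left_mono) (auto simp: pos_le_divide_eq less_imp_le)
    then show "t - (q - p) * (1/2) ^ K \<le> d K (i K)" using pq
      by (simp add: d_def power_one_over add_divide_distrib distrib_left)
  qed
  have "(\<lambda>K. t - (q - p) * (1/2) ^ K) \<longlonglongrightarrow> t - (q - p) * 0"
    by (intro tendsto_intros LIMSEQ_power_zero) auto
  then have lower: "(\<lambda>K. t - (q - p) * (1/2) ^ K) \<longlonglongrightarrow> t" by simp
  have "(\<lambda>K. d K (i K)) \<longlonglongrightarrow> t"
    by (rule tendsto_sandwich[OF _ _ lower tendsto_const]) (rule always_eventually, rule allI, rule bounds)+
  moreover have "d K (i K) \<in> {p..q}" for K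
    using bounds(1)[of K] t pq by (auto simp: d_def)
  ultimately have "(\<lambda>K. g (d K (i K))) \<longlonglongrightarrow> g t"
    using cont t by (intro continuous_on_tendsto_compose[OF cont]) auto
  then have "(\<lambda>K. \<bar>g (d K (i K)) - g q\<bar>) \<longlonglongrightarrow> \<bar>g t - g q\<bar>"
    by (intro tendsto_intros)
  moreover have "\<bar>g (d K (i K)) - g q\<bar> \<le> suminf c" for K
    using sum_le_suminf[OF c(2), of "{..K}"] c(1) by (intro order_trans[OF dyadic[OF i2]]) simp
  ultimately show ?thesis
    using LIMSEQ_le_const2 by blast
qed

section \<open>Concave and regularly varying functions at zero\<close>

text \<open>A concave function that decreases somewhere lies below a line of negative slope from there on,
  and would become negative.\<close>
lemma concave_pos_mono:
  fixes f :: "real \<Rightarrow> real"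
  assumes conc: "concave_on {0<..} f" and pos: "\<And>t. 0 < t \<Longrightarrow> 0 < f t"
    and st: "0 < s" "s \<le> t"
  shows "f s \<le> f t"
proof (cases "s = t")
  case False
  with st have lt: "s < t" by simp
  have "(1 - 1 / real (Suc k)) * f s \<le> f t" for k
  proof -
    let ?v = "s + real (Suc k) * (t - s)"
    have v: "0 < ?v" using st lt by (intro add_pos_pos mult_pos_pos) auto
    have "(1 - 1 / real (Suc k)) * f s + (1 / real (Suc k)) * f ?v
        \<le> f ((1 - 1 / real (Suc k)) *\<^sub>R s + (1 / real (Suc k)) *\<^sub>R ?v)"
      using st v by (intro concave_onD[OF conc]) auto
    also have "(1 - 1 / real (Suc k)) *\<^sub>R s + (1 / real (Suc k)) *\<^sub>R ?v = t"
      by (simp add: field_simps del: of_nat_Suc)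
    finally show ?thesis
      using pos[OF v] by (smt (verit) divide_nonneg_nonneg mult_nonneg_nonneg of_nat_0_le_iff)
  qed
  moreover have "(\<lambda>k. (1 - 1 / real (Suc k)) * f s) \<longlonglongrightarrow> (1 - 0) * f s"
    by (intro tendsto_intros LIMSEQ_inverse_real_of_nat[unfolded inverse_eq_divide])
  ultimately show ?thesis
    using LIMSEQ_le_const2 by fastforce
qed simp

text \<open>The chord from the origin: by positivity near 0, concavity between \<open>e\<close> and \<open>t\<close> gives
  \<open>f s \<ge> (s - e) / (t - e) * f t\<close>, and \<open>e\<close> tends to 0.\<close>
lemma concave_pos_ratio_mono:
  fixes f :: "real \<Rightarrow> real"
  assumes conc: "concave_on {0<..} f" and pos: "\<And>t. 0 < t \<Longrightarrow> 0 < f t"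
    and st: "0 < s" "s \<le> t"
  shows "s / f s \<le> t / f t"
proof (cases "s = t")
  case False
  with st have lt: "s < t" by simp
  have "s / t * f t \<le> f s"
  proof (rule tendsto_upperbound)
    show "((\<lambda>e. (s - e) / (t - e) * f t) \<longlongrightarrow> s / t * f t) (at_right 0)"
      using st lt by (auto intro!: tendsto_eq_intros)
    show "\<forall>\<^sub>F e in at_right 0. (s - e) / (t - e) * f t \<le> f s"
      using eventually_at_right_less[of 0] eventually_at_right_real[OF st(1)]
    proof eventually_elim
      case (elim e)
      let ?l = "(s - e) / (t - e)"
      have l: "0 \<le> ?l" "?l \<le> 1" using elim lt by auto
      have "(1 - ?l) * f e + ?l * f t \<le> f ((1 - ?l) *\<^sub>R e + ?l *\<^sub>R t)"
        using elim lt l by (intro concave_onD[OF conc]) auto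
      also have "(1 - ?l) *\<^sub>R e + ?l *\<^sub>R t = e + ?l * (t - e)"
      proof -
        have "(1 - l) *\<^sub>R e + l *\<^sub>R t = e + l * (t - e)" for l
          by (simp add: algebra_simps)
        then show ?thesis .
      qed
      also have "\<dots> = s" using elim lt by simp
      finally show ?case
        using mult_nonneg_nonneg[of "1 - ?l" "f e"] l pos[of e] elim by linarith
    qed
  qed simp
  then show ?thesis
    using st pos[of s] pos[of t] by (simp add: field_simps)
qed simp

lemma concave_slope_bound:
  fixes f :: "real \<Rightarrow> real"
  assumes conc: "concave_on {0<..} f" and pos: "\<And>t. 0 < t \<Longrightarrow> 0 < f t"
    and st: "0 < s" "s < t"
  shows "\<bar>s / f s - t / f t\<bar> \<le> (t - s) / f t"
proof -
  have "s / f t \<le> s / f s"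
    using concave_pos_mono[OF conc pos, of s t] st pos[of s] by (intro divide_left_mono) auto
  then show ?thesis
    using concave_pos_ratio_mono[OF conc pos, of s t] st by (simp add: diff_divide_distrib)
qed

text \<open>Halving \<open>t\<close> multiplies \<open>t / f t\<close> by a factor tending to \<open>2 powr (\<rho> - 1) < 1\<close>, so the ratio
  decays geometrically along powers of two; monotonicity of the ratio fills the gaps. Regular variation
  enters the proof through this power bound.\<close>
lemma regularly_varying_ratio_powr_bound:
  fixes f :: "real \<Rightarrow> real"
  assumes conc: "concave_on {0<..} f" and pos: "\<And>t. 0 < t \<Longrightarrow> 0 < f t"
    and rv: "regularly_varying_at_zero f \<rho>" and \<rho>: "\<rho> < 1"
  obtains C \<gamma> t0 where "0 < C" "0 < \<gamma>" "0 < t0" "\<And>t. 0 < t \<Longrightarrow> t \<le> t0 \<Longrightarrow> t / f t \<le> C * t powr \<gamma>"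
proof -
  let ?h = "\<lambda>t. t / f t"
  define r where "r = (2 powr (\<rho> - 1) + 1) / 2"
  have p1: "2 powr (\<rho> - 1) < 1" using \<rho> powr_less_mono[of "\<rho> - 1" 0 2] by simp
  have p0: "0 < 2 powr (\<rho> - 1)" by simp
  have r: "0 < r" "r < 1" "2 powr (\<rho> - 1) < r"
    using p1 p0 by (simp_all add: r_def add_pos_pos)
  have "\<forall>c>0. ((\<lambda>t. f (c * t) / f t) \<longlongrightarrow> c powr \<rho>) (at_right 0)"
    using rv unfolding regularly_varying_at_zero_def by blast
  then have "((\<lambda>t. f (1/2 * t) / f t) \<longlongrightarrow> (1/2) powr \<rho>) (at_right 0)"
    by (rule allE[of _ "1/2"]) simp
  moreover have "(1/2) / r < (1/2) powr \<rho>"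
  proof -
    have "2 powr (\<rho> - 1) = 1 / (2 * (1/2) powr \<rho>)"
      by (simp add: powr_diff powr_divide)
    moreover have "2 powr (\<rho> - 1) * (2 * (1/2) powr \<rho>) < r * (2 * (1/2) powr \<rho>)"
      by (rule mult_strict_right_mono[OF r(3)]) simp
    ultimately show ?thesis using r by (simp add: field_simps)
  qed
  ultimately have "\<forall>\<^sub>F t in at_right 0. (1/2) / r < f (1/2 * t) / f t"
    by (rule order_tendstoD(1))
  then obtain b where b: "0 < b" "\<And>t. 0 < t \<Longrightarrow> t < b \<Longrightarrow> (1/2) / r < f (1/2 * t) / f t"
    by (auto simp: eventually_at_right_field)
  define t0 where "t0 = b / 2"
  have t0: "0 < t0" "t0 < b" using b by (simp_all add: t0_def)
  have halve: "?h (t / 2) \<le> r * ?h t" if "0 < t" "t \<le> t0" for t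
  proof -
    have "(1/2) / r < f (t / 2) / f t" using b(2)[of t] that t0 by simp
    then have "f t < 2 * r * f (t / 2)" using r pos[of t] that by (simp add: field_simps)
    then show ?thesis using pos[of t] pos[of "t/2"] that by (simp add: field_simps)
  qed
  have iter: "?h (t0 / 2 ^ n) \<le> r ^ n * ?h t0" for n
  proof (induction n)
    case (Suc n)
    have "?h (t0 / 2 ^ n / 2) \<le> r * ?h (t0 / 2 ^ n)"
      by (rule halve) (use t0 in \<open>auto simp: field_simps\<close>)
    also have "\<dots> \<le> r * (r ^ n * ?h t0)" using Suc r by (intro mult_left_mono) auto
    finally show ?case by (simp add: ac_simps)
  qed simp
  (* The exponent for which a factor r per halving is exactly a power of t. *)
  define \<gamma> where "\<gamma> = - log 2 r"
  have \<gamma>: "0 < \<gamma>" using r by (simp add: \<gamma>_def)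
  have rg: "r = (1/2) powr \<gamma>"
    using r by (simp add: \<gamma>_def powr_minus powr_divide)
  define C where "C = ?h t0 / r / t0 powr \<gamma>"
  show ?thesis
  proof (rule that[of C \<gamma> t0])
    show "0 < C" using t0 pos[of t0] r by (simp add: C_def)
    fix t :: real assume t: "0 < t" "t \<le> t0"
    define n where "n = nat \<lfloor>log 2 (t0 / t)\<rfloor>"
    have "0 \<le> log 2 (t0 / t)" using t by simp
    then have n: "real n \<le> log 2 (t0 / t)" "log 2 (t0 / t) < real n + 1"
      by (simp_all add: n_def)
    have "2 ^ n \<le> t0 / t"
      using n(1) t by (simp add: le_log_iff powr_realpow)
    then have le: "t \<le> t0 / 2 ^ n" using t by (simp add: field_simps)
    have "t0 / t < 2 * 2 ^ n"
      using n(2) t t0 by (simp add: log_less_iff powr_add powr_realpow)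
    then have ge: "1 / 2 ^ n \<le> 2 * (t / t0)" using t t0 by (simp add: field_simps)
    have "?h t \<le> ?h (t0 / 2 ^ n)"
      by (rule concave_pos_ratio_mono[OF conc pos t(1) le])
    also have "\<dots> \<le> r ^ n * ?h t0" by (rule iter)
    also have "r ^ n = (1 / 2 ^ n) powr \<gamma>"
      by (simp add: rg powr_divide powr_powr powr_realpow[symmetric] mult.commute)
    also have "\<dots> \<le> (2 * (t / t0)) powr \<gamma>"
      using ge \<gamma> by (intro powr_mono2) auto
    also have "\<dots> = (t powr \<gamma> / t0 powr \<gamma>) / r"
      using t t0 by (simp add: powr_mult powr_divide rg)
    finally show "?h t \<le> C * t powr \<gamma>"
      using t t0 pos[of t0] by (simp add: C_def mult_right_mono field_simps)
  qed (use \<gamma> t0 in auto)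
qed

section \<open>Nearly geometric meshes at zero\<close>

text \<open>For \<open>\<beta>\<close> in \<open>(0, 1)\<close> the mesh is finer than geometric, so that consecutive points have
  ratio tending to 1, while \<open>ln (ln (1 / t))\<close> still equals \<open>\<beta> * ln n\<close> at the \<open>n\<close>-th point: for
  \<open>\<beta>\<close> close to 1 little is lost against a geometric mesh.\<close>
definition mesh :: "real \<Rightarrow> nat \<Rightarrow> real" where
  "mesh \<beta> n = exp (- (real n powr \<beta>))"

lemma mesh_pos: "0 < mesh \<beta> n"
  by (simp add: mesh_def)

lemma mesh_less: "0 < \<beta> \<Longrightarrow> mesh \<beta> (Suc n) < mesh \<beta> n"
  by (simp add: mesh_def powr_less_mono2)

lemma mesh_tendsto_0: "0 < \<beta> \<Longrightarrow> mesh \<beta> \<longlonglongrightarrow> 0"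
  unfolding mesh_def[abs_def] by real_asymp

lemma mesh_ratio: "mesh \<beta> n / mesh \<beta> (Suc n) = exp ((real n + 1) powr \<beta> - real n powr \<beta>)"
  by (simp add: mesh_def exp_diff exp_minus divide_simps add.commute)

lemma mesh_ratio_tendsto_1:
  assumes "0 < \<beta>" "\<beta> < 1"
  shows "(\<lambda>n. mesh \<beta> n / mesh \<beta> (Suc n)) \<longlonglongrightarrow> 1"
  unfolding mesh_ratio using assms by real_asymp

text \<open>Up to a random constant, a bound for the oscillation of the normalized process over one cell of
  the mesh, relative to its natural scale \<open>sqrt (t / f t)\<close>; the logarithm is the price of a bound that holds almost
  surely for all cells at once.\<close>
definition mesh_defect :: "real \<Rightarrow> nat \<Rightarrow> real" where
  "mesh_defect \<beta> n = (1 + ln (real n + 1)) * sqrt (mesh \<beta> n / mesh \<beta> (Suc n) - 1)"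

lemma mesh_defect_nonneg: "0 < \<beta> \<Longrightarrow> 0 \<le> mesh_defect \<beta> n"
  using mesh_less[of \<beta> n] mesh_pos[of \<beta> "Suc n"]
  by (auto simp: mesh_defect_def le_divide_eq intro!: mult_nonneg_nonneg add_nonneg_nonneg)

lemma mesh_defect_tendsto_0:
  assumes "0 < \<beta>" "\<beta> < 1"
  shows "mesh_defect \<beta> \<longlonglongrightarrow> 0"
  unfolding mesh_defect_def[abs_def] mesh_ratio using assms by real_asymp

lemma mesh_powr_ln_tendsto_0:
  assumes "0 < \<beta>" "0 < \<gamma>" 
  shows "(\<lambda>n. ln (real n) * mesh \<beta> n powr \<gamma>) \<longlonglongrightarrow> 0"
  unfolding mesh_def using assms by real_asymp

lemma mesh_powr_bigo:
  assumes "0 < \<beta>" "0 < \<gamma>"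
  shows "(\<lambda>n. mesh \<beta> n powr \<gamma>) \<in> O(\<lambda>n. 1 / (real n)\<^sup>2)"
  unfolding mesh_def using assms by real_asymp

lemma mesh_powr_summable: "0 < \<beta> \<Longrightarrow> \<beta> < 1 \<Longrightarrow> summable (\<lambda>n. real n powr (- 1 / \<beta>))"
  by (subst summable_real_powr_iff) (simp add: field_simps)

lemma ln_ln_inverse_mesh:
  assumes "0 < \<beta>" "2 \<le> n" "0 < t" "t \<le> mesh \<beta> n"
  shows "\<beta> * ln (real n) \<le> ln (ln (1 / t))"
proof -
  have "ln t \<le> ln (mesh \<beta> n)" using assms mesh_pos[of \<beta> n] by simp
  then have "real n powr \<beta> \<le> ln (1 / t)" using assms by (simp add: mesh_def ln_div)
  moreover have "0 < real n powr \<beta>" using assms by simp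
  ultimately have "ln (real n powr \<beta>) \<le> ln (ln (1 / t))"
    using ln_le_cancel_iff less_le_trans by blast
  then show ?thesis using assms by (simp add: ln_powr)
qed

lemma eventually_at_right_of_blocks:
  fixes T :: "nat \<Rightarrow> real"
  assumes T0: "T \<longlonglongrightarrow> 0" and dec: "\<And>n. T (Suc n) \<le> T n" and pos: "\<And>n. 0 < T n"
    and ev: "\<forall>\<^sub>F n in sequentially. \<forall>t\<in>{T (Suc n)..T n}. P t"
  shows "\<forall>\<^sub>F t in at_right 0. P t"
proof -
  obtain N where N: "\<forall>n\<ge>N. \<forall>t\<in>{T (Suc n)..T n}. P t"
    using ev unfolding eventually_sequentially by blast
  have "P t" if t: "0 < t" "t < T N" for t
  proof -
    have "\<forall>\<^sub>F n in sequentially. T n < t \<and> N \<le> n"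
      using order_tendstoD(2)[OF T0 t(1)] eventually_ge_at_top[of N] by eventually_elim simp
    then obtain m where m: "T m < t" "N \<le> m"
      unfolding eventually_sequentially by blast
    define k where "k = (LEAST k. N \<le> k \<and> T k \<le> t)"
    have k: "N \<le> k \<and> T k \<le> t"
      unfolding k_def by (rule LeastI[of _ m]) (use m in auto)
    have "k \<noteq> N" using k t by auto
    then obtain j where j: "k = Suc j" "N \<le> j"
      using k by (metis le_SucE not0_implies_Suc le_zero_eq)
    have "\<not> (N \<le> j \<and> T j \<le> t)"
      by (rule not_less_Least) (simp add: k_def[symmetric] j)
    with j k N show ?thesis by auto
  qed
  then show ?thesis
    using pos[of N] by (auto simp: eventually_at_right_field)
qed

lemma tendsto_at_right_of_blocks:
  fixes T :: "nat \<Rightarrow> real" and g :: "real \<Rightarrow> real"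
  assumes T: "T \<longlonglongrightarrow> 0" "\<And>n. T (Suc n) \<le> T n" "\<And>n. 0 < T n"
    and osc: "\<forall>\<^sub>F n in sequentially. \<forall>t\<in>{T (Suc n)..T n}. \<bar>g t - g (T n)\<bar> \<le> u n"
    and u: "u \<longlonglongrightarrow> 0" and l: "(\<lambda>n. g (T n)) \<longlonglongrightarrow> l"
  shows "(g \<longlongrightarrow> l) (at_right 0)"
proof (rule tendstoI)
  fix e :: real assume e: "0 < e"
  have "\<forall>\<^sub>F n in sequentially. u n < e / 2" "\<forall>\<^sub>F n in sequentially. dist (g (T n)) l < e / 2"
    using order_tendstoD(2)[OF u, of "e / 2"] tendstoD[OF l, of "e / 2"] e by auto
  with osc have "\<forall>\<^sub>F n in sequentially. \<forall>t\<in>{T (Suc n)..T n}. dist (g t) l < e"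
  proof eventually_elim
    case (elim n)
    show ?case
    proof
      fix t assume "t \<in> {T (Suc n)..T n}"
      with elim(1) have "\<bar>g t - g (T n)\<bar> \<le> u n" by blast
      with elim(2,3) show "dist (g t) l < e" unfolding dist_real_def by linarith
    qed
  qed
  then show "\<forall>\<^sub>F t in at_right 0. dist (g t) l < e"
    by (rule eventually_at_right_of_blocks[OF T])
qed

section \<open>Laplace transforms of permanental vectors\<close>

lemma det_2x2:
  assumes "A \<in> carrier_mat 2 2"
  shows "Determinant.det A = A $$ (0, 0) * A $$ (1, 1) - A $$ (0, 1) * A $$ (1, 0 :: nat)"
proof -
  have "Determinant.det A = (\<Sum>j<2. A $$ (0, j) * cofactor A 0 j)"
    using assms by (intro laplace_expansion_row) auto
  also have "\<dots> = A $$ (0, 0) * cofactor A 0 0 + A $$ (0, 1) * cofactor A 0 1"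
    by (simp add: numeral_2_eq_2)
  also have "cofactor A 0 0 = A $$ (1, 1)"
    unfolding cofactor_def using assms by (subst det_single) (auto simp: mat_delete_def)
  also have "cofactor A 0 1 = - A $$ (1, 0)"
    unfolding cofactor_def using assms by (subst det_single) (auto simp: mat_delete_def)
  finally show ?thesis by simp
qed

lemma permanental_processD:
  assumes "permanental_process M \<alpha> T u Z" and "\<And>i. i < n \<Longrightarrow> t i \<in> T"
  shows "i < n \<Longrightarrow> Z (t i) \<in> borel_measurable M"
    and "i < n \<Longrightarrow> AE \<omega> in M. 0 \<le> Z (t i) \<omega>"
    and "(\<And>i. i < n \<Longrightarrow> 0 < c i) \<Longrightarrow> (\<integral>\<omega>. exp (- (\<Sum>i<n. c i * Z (t i) \<omega>)) \<partial>M)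
      = Determinant.det (1\<^sub>m n + mat n n (\<lambda>(i, j). u (t i) (t j))
          * mat n n (\<lambda>(i, j). if i = j then c i else 0)) powr (- \<alpha>)"
proof -
  let ?S = "mat n n (\<lambda>(i, j). if i = j then c i else 0)"
  have v: "permanental_vector M \<alpha> n (\<lambda>i. Z (t i)) (mat n n (\<lambda>(i, j). u (t i) (t j)))"
    using assms unfolding permanental_process_def by blast
  then show "i < n \<Longrightarrow> Z (t i) \<in> borel_measurable M" "i < n \<Longrightarrow> AE \<omega> in M. 0 \<le> Z (t i) \<omega>"
    unfolding permanental_vector_def by blast+
  assume "\<And>i. i < n \<Longrightarrow> 0 < c i"
  then have "?S \<in> carrier_mat n n" "diagonal_mat ?S \<and> (\<forall>i<n. 0 < ?S $$ (i, i))"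
    by (auto simp: diagonal_mat_def)
  with v have "(\<integral>\<omega>. exp (- (\<Sum>i<n. ?S $$ (i, i) * Z (t i) \<omega>)) \<partial>M)
      = Determinant.det (1\<^sub>m n + mat n n (\<lambda>(i, j). u (t i) (t j)) * ?S) powr (- \<alpha>)"
    unfolding permanental_vector_def by blast
  then show "(\<integral>\<omega>. exp (- (\<Sum>i<n. c i * Z (t i) \<omega>)) \<partial>M)
      = Determinant.det (1\<^sub>m n + mat n n (\<lambda>(i, j). u (t i) (t j)) * ?S) powr (- \<alpha>)"
    by simp
qed

text \<open>The setting of the theorem, with regular variation replaced by the power bound that it
  implies for concave functions.\<close>
locale permanental_min_plus = prob_space M for M :: "'a measure" +
  fixes \<alpha> :: real and f :: "real \<Rightarrow> real" and Z :: "real \<Rightarrow> 'a \<Rightarrow> real"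
    and C \<gamma> t0 :: real
  assumes \<alpha>_pos: "0 < \<alpha>"
    and f_pos: "0 < t \<Longrightarrow> 0 < f t"
    and f_concave: "concave_on {0<..} f"
    and ratio_bound: "0 < t \<Longrightarrow> t \<le> t0 \<Longrightarrow> t / f t \<le> C * t powr \<gamma>"
    and ratio_consts: "0 < C" "0 < \<gamma>" "0 < t0"
    and perm: "permanental_process M \<alpha> {0<..} (u_tilde f) Z"
    and cont: "AE \<omega> in M. continuous_on {0<..} (\<lambda>t. Z t \<omega>)"
begin

lemma Z_measurable: "0 < t \<Longrightarrow> Z t \<in> borel_measurable M"
  and Z_nonneg: "0 < t \<Longrightarrow> AE \<omega> in M. 0 \<le> Z t \<omega>"
  using permanental_processD(1,2)[OF perm, of 1 "\<lambda>_. t" 0] by simp_all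

lemma laplace_one:
  assumes t: "0 < t" and b: "0 < b"
  shows "(\<integral>\<omega>. exp (- (b * Z t \<omega>)) \<partial>M) = (1 + b * (t + f t)) powr (- \<alpha>)"
proof -
  have "(\<integral>\<omega>. exp (- (\<Sum>i<1::nat. b * Z t \<omega>)) \<partial>M) = Determinant.det (1\<^sub>m 1 +
      mat 1 1 (\<lambda>(i, j). u_tilde f t t) * mat 1 1 (\<lambda>(i, j). if i = j then b else 0)) powr (- \<alpha>)"
    by (rule permanental_processD(3)[OF perm, of 1 "\<lambda>_. t" "\<lambda>_. b"]) (use t b in auto)
  also have "Determinant.det (1\<^sub>m 1 + mat 1 1 (\<lambda>(i, j). u_tilde f t t) * mat 1 1 (\<lambda>(i, j). if i = j then b else 0))
      = 1 + b * (t + f t)"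
    by (subst det_single) (auto simp: scalar_prod_def u_tilde_def)
  finally show ?thesis by simp
qed

lemma laplace_two:
  assumes st: "0 < s" "s < t" and ab: "0 < a" "0 < b"
  shows "(\<integral>\<omega>. exp (- (a * Z s \<omega> + b * Z t \<omega>)) \<partial>M)
    = (1 + a * (s + f s) + b * (t + f t) + a * b * (s + f s) * (t - s)) powr (- \<alpha>)"
proof -
  let ?t = "\<lambda>i::nat. if i = 0 then s else t" and ?c = "\<lambda>i::nat. if i = 0 then a else b"
  let ?U = "mat 2 2 (\<lambda>(i, j). u_tilde f (?t i) (?t j))"
  let ?S = "mat 2 2 (\<lambda>(i, j). if i = j then ?c i else 0)"
  have "(\<integral>\<omega>. exp (- (\<Sum>i<2. ?c i * Z (?t i) \<omega>)) \<partial>M) = Determinant.det (1\<^sub>m 2 + ?U * ?S) powr (- \<alpha>)"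
    by (rule permanental_processD(3)[OF perm]) (use st ab in auto)
  moreover have "Determinant.det (1\<^sub>m 2 + ?U * ?S) = 1 + a * (s + f s) + b * (t + f t) + a * b * (s + f s) * (t - s)"
    using st by (subst det_2x2) (auto simp: scalar_prod_def u_tilde_def numeral_2_eq_2 algebra_simps)
  moreover have "(\<Sum>i<2. ?c i * Z (?t i) \<omega>) = a * Z s \<omega> + b * Z t \<omega>" for \<omega>
    by (simp add: numeral_2_eq_2)
  ultimately show ?thesis by (simp only:)
qed

lemma f_mono: "0 < s \<Longrightarrow> s \<le> t \<Longrightarrow> f s \<le> f t"
  and ratio_mono: "0 < s \<Longrightarrow> s \<le> t \<Longrightarrow> s / f s \<le> t / f t"
  and ratio_slope: "0 < s \<Longrightarrow> s < t \<Longrightarrow> \<bar>s / f s - t / f t\<bar> \<le> (t - s) / f t"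
  using concave_pos_mono[OF f_concave f_pos] concave_pos_ratio_mono[OF f_concave f_pos]
    concave_slope_bound[OF f_concave f_pos] by auto

text \<open>Boundary values of the parameters are included because \<open>laplace_extension\<close> needs the total
  mass of the weighted measure.\<close>
lemma laplace_two_nn:
  assumes st: "0 < s" "s < t" and ab: "0 \<le> a" "0 \<le> b"
  shows "(\<integral>\<^sup>+\<omega>. exp (- (a * Z s \<omega> + b * Z t \<omega>)) \<partial>M)
    = ennreal ((1 + a * (s + f s) + b * (t + f t) + a * b * (s + f s) * (t - s)) powr (- \<alpha>))"
proof -
  have t: "0 < t" using st by simp
  note [measurable] = Z_measurable[OF st(1)] Z_measurable[OF t]
  have "(\<integral>\<^sup>+\<omega>. exp (- (a * Z s \<omega> + b * Z t \<omega>)) \<partial>M) = ennreal (\<integral>\<omega>. exp (- (a * Z s \<omega> + b * Z t \<omega>)) \<partial>M)"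
  proof (rule nn_integral_exp_uminus)
    show "(\<lambda>\<omega>. a * Z s \<omega> + b * Z t \<omega>) \<in> borel_measurable M" by measurable
    show "AE \<omega> in M. 0 \<le> a * Z s \<omega> + b * Z t \<omega>"
      using Z_nonneg[of s] Z_nonneg[of t] st ab by (auto elim!: eventually_elim2)
  qed
  also have "(\<integral>\<omega>. exp (- (a * Z s \<omega> + b * Z t \<omega>)) \<partial>M)
      = (1 + a * (s + f s) + b * (t + f t) + a * b * (s + f s) * (t - s)) powr (- \<alpha>)"
  proof (cases "0 < a"; cases "0 < b")
    assume "0 < a" "0 < b"
    then show ?thesis using laplace_two[OF st] by simp
  next
    assume "0 < a" "\<not> 0 < b"
    then show ?thesis using laplace_one[of s a] st ab by simp
  next
    assume "\<not> 0 < a" "0 < b"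
    then show ?thesis using laplace_one[of t b] st ab by simp
  next
    assume "\<not> 0 < a" "\<not> 0 < b"
    then have "a = 0" "b = 0" using ab by auto
    then show ?thesis by (simp add: prob_space)
  qed
  finally show ?thesis .
qed

text \<open>The polynomial is affine in each variable, so \<open>laplace_extension\<close> applies to one of them while the
  other, which keeps its sign, provides the weight.\<close>
lemma laplace_two_extended:
  assumes st: "0 < s" "s < t" and ab: "0 \<le> a \<or> 0 \<le> b"
    and P: "0 < 1 + a * (s + f s) + b * (t + f t) + a * b * (s + f s) * (t - s)"
  shows "(\<integral>\<^sup>+\<omega>. exp (- (a * Z s \<omega> + b * Z t \<omega>)) \<partial>M)
    = ennreal ((1 + a * (s + f s) + b * (t + f t) + a * b * (s + f s) * (t - s)) powr (- \<alpha>))"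
proof -
  have t: "0 < t" using st by simp
  note [measurable] = Z_measurable[OF st(1)] Z_measurable[OF t]
  have fs: "0 < s + f s" and ft: "0 < t + f t" using f_pos[of s] f_pos[of t] st by auto
  from ab show ?thesis
  proof
    assume a: "0 \<le> a"
    let ?A = "1 + a * (s + f s)" and ?B = "t + f t + a * (s + f s) * (t - s)"
    have "0 \<le> a * (s + f s)" "0 \<le> a * (s + f s) * (t - s)"
      using a fs st by (auto intro!: mult_nonneg_nonneg)
    then have AB: "0 < ?A" "0 < ?B" using ft by linarith+
    have AB_eq: "?A + ?B * r = 1 + a * (s + f s) + r * (t + f t) + a * r * (s + f s) * (t - s)" for r
      by (simp add: algebra_simps)
    have "(\<integral>\<^sup>+\<omega>. exp (- a * Z s \<omega>) * exp (- b * Z t \<omega>) \<partial>M) = ennreal ((?A + ?B * b) powr (- \<alpha>))"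
      by (rule laplace_extension[OF \<alpha>_pos AB])
         (use P Z_nonneg[OF t] laplace_two_nn[OF st a] in \<open>auto simp: AB_eq exp_add[symmetric] algebra_simps\<close>)
    then show ?thesis by (simp add: AB_eq exp_add[symmetric] algebra_simps)
  next
    assume b: "0 \<le> b"
    let ?A = "1 + b * (t + f t)" and ?B = "(s + f s) * (1 + b * (t - s))"
    have "0 \<le> b * (t + f t)" "0 \<le> b * (t - s)"
      using b ft st by (auto intro!: mult_nonneg_nonneg)
    then have AB: "0 < ?A" "0 < ?B" using fs by (auto intro!: mult_pos_pos)
    have AB_eq: "?A + ?B * r = 1 + r * (s + f s) + b * (t + f t) + r * b * (s + f s) * (t - s)" for r
      by (simp add: algebra_simps)
    have "(\<integral>\<^sup>+\<omega>. exp (- b * Z t \<omega>) * exp (- a * Z s \<omega>) \<partial>M) = ennreal ((?A + ?B * a) powr (- \<alpha>))"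
      by (rule laplace_extension[OF \<alpha>_pos AB])
         (use P Z_nonneg[OF st(1)] laplace_two_nn[OF st _ b] in \<open>auto simp: AB_eq exp_add[symmetric] algebra_simps\<close>)
    then show ?thesis by (simp add: AB_eq exp_add[symmetric] algebra_simps)
  qed
qed

text \<open>Normalizing by \<open>f\<close> removes the drift: \<open>Z t\<close> alone moves from \<open>s\<close> to \<open>t\<close> by about
  \<open>(f t - f s) * \<xi>\<close>, which can be much larger than the fluctuations.\<close>
definition G :: "real \<Rightarrow> 'a \<Rightarrow> real" where
  "G t \<omega> = Z t \<omega> / f t"

lemma G_measurable: "0 < t \<Longrightarrow> G t \<in> borel_measurable M"
  unfolding G_def[abs_def] using Z_measurable[of t] by simp

text \<open>Both terms that \<open>\<theta>\<close> contributes to the polynomial are controlled by \<open>x = (t - s) / f t\<close>: the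
  quadratic one directly, the linear one because \<open>t / f t\<close> varies by at most \<open>x\<close> between \<open>s\<close> and \<open>t\<close>.
  With \<open>\<bar>\<theta>\<bar> * sqrt x \<le> 1 / 4\<close> the polynomial stays above one half.\<close>
lemma increment_exp_bound:
  assumes st: "0 < s" "s < t" and tf: "t \<le> f t" and \<theta>: "\<bar>\<theta>\<bar> \<le> sqrt (f t / (t - s)) / 4"
  shows "(\<integral>\<^sup>+\<omega>. exp (\<theta> * (G t \<omega> - G s \<omega>)) \<partial>M) \<le> ennreal (2 powr \<alpha>)"
proof -
  have t: "0 < t" using st by simp
  have f: "0 < f s" "0 < f t" using st f_pos by auto
  define x where "x = (t - s) / f t"
  have x: "0 < x" "x \<le> 1" using st f tf by (auto simp: x_def)
  have "\<bar>\<theta>\<bar> \<le> 1 / (4 * sqrt x)"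
    using \<theta> by (simp add: x_def real_sqrt_divide)
  then have th: "\<bar>\<theta>\<bar> * sqrt x \<le> 1/4" using x by (simp add: field_simps)
  have "\<bar>\<theta>\<bar> * x = (\<bar>\<theta>\<bar> * sqrt x) * sqrt x" using x by (simp add: mult.assoc)
  also have "\<dots> \<le> 1/4 * 1" using th x by (intro mult_mono) auto
  finally have th1: "\<bar>\<theta>\<bar> * x \<le> 1/4" by simp
  have "\<theta>\<^sup>2 * x = (\<bar>\<theta>\<bar> * sqrt x)\<^sup>2" using x by (simp add: power_mult_distrib)
  also have "\<dots> \<le> (1/4)\<^sup>2" using th x by (intro power_mono) auto
  finally have th2: "\<theta>\<^sup>2 * x \<le> 1/16" by (simp add: power2_eq_square)
  let ?P = "1 + \<theta> / f s * (s + f s) + (- \<theta> / f t) * (t + f t) + \<theta> / f s * (- \<theta> / f t) * (s + f s) * (t - s)"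
  have P_eq: "?P = 1 + \<theta> * (s / f s - t / f t) - \<theta>\<^sup>2 * x * (1 + s / f s)"
    using f by (simp add: x_def field_simps power2_eq_square)
  have "\<bar>\<theta> * (s / f s - t / f t)\<bar> \<le> \<bar>\<theta>\<bar> * x"
    unfolding abs_mult x_def by (intro mult_left_mono ratio_slope st) auto
  moreover have "s / f s \<le> 1"
    using ratio_mono[of s t] st tf f by (smt (verit) divide_le_eq_1_pos)
  then have "\<theta>\<^sup>2 * x * (1 + s / f s) \<le> 1/16 * 2"
    using th2 x st f by (intro mult_mono) auto
  ultimately have P: "1/2 \<le> ?P"
    unfolding P_eq using th1 by linarith
  have "(\<integral>\<^sup>+\<omega>. exp (- (\<theta> / f s * Z s \<omega> + (- \<theta> / f t) * Z t \<omega>)) \<partial>M) = ennreal (?P powr (- \<alpha>))"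
  proof (rule laplace_two_extended[OF st])
    show "0 \<le> \<theta> / f s \<or> 0 \<le> - \<theta> / f t" using f by (cases "0 \<le> \<theta>") (auto intro: divide_nonneg_pos divide_nonpos_pos)
  qed (use P in linarith)
  moreover have "- (\<theta> / f s * Z s \<omega> + (- \<theta> / f t) * Z t \<omega>) = \<theta> * (G t \<omega> - G s \<omega>)" for \<omega>
    using f by (simp add: G_def field_simps)
  moreover have "?P powr (- \<alpha>) \<le> (1/2) powr (- \<alpha>)"
    using P \<alpha>_pos by (intro powr_mono2') auto
  moreover have "(1/2) powr (- \<alpha>) = 2 powr \<alpha>" by (simp add: powr_minus powr_divide)
  ultimately show ?thesis by (simp add: ennreal_leI)
qed

lemma increment_exp_abs_bound:
  assumes st: "0 < s" "s < t" and tf: "t \<le> f t"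
  shows "(\<integral>\<^sup>+\<omega>. exp (sqrt (f t / (t - s)) / 4 * \<bar>G t \<omega> - G s \<omega>\<bar>) \<partial>M) \<le> ennreal (2 * 2 powr \<alpha>)"
proof -
  have t: "0 < t" using st by simp
  note [measurable] = G_measurable[OF st(1)] G_measurable[OF t]
  let ?c = "sqrt (f t / (t - s)) / 4" and ?D = "\<lambda>\<omega>. G t \<omega> - G s \<omega>"
  have c: "0 \<le> ?c" using f_pos[OF t] st by simp
  have "(\<integral>\<^sup>+\<omega>. exp (?c * \<bar>?D \<omega>\<bar>) \<partial>M) \<le> (\<integral>\<^sup>+\<omega>. ennreal (exp (?c * ?D \<omega>)) + ennreal (exp (- ?c * ?D \<omega>)) \<partial>M)"
  proof (intro nn_integral_mono)
    fix \<omega>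
    have "exp (c * \<bar>x\<bar>) \<le> exp (c * x) + exp (- c * x)" for c x :: real
      by (cases "0 \<le> x") simp_all
    from this[of ?c "?D \<omega>"] show "ennreal (exp (?c * \<bar>?D \<omega>\<bar>)) \<le> ennreal (exp (?c * ?D \<omega>)) + ennreal (exp (- ?c * ?D \<omega>))"
      by (simp add: ennreal_plus[symmetric] ennreal_leI del: ennreal_plus)
  qed
  also have "\<dots> = (\<integral>\<^sup>+\<omega>. exp (?c * ?D \<omega>) \<partial>M) + (\<integral>\<^sup>+\<omega>. exp (- ?c * ?D \<omega>) \<partial>M)"
    by (rule nn_integral_add) auto
  also have "\<dots> \<le> ennreal (2 powr \<alpha>) + ennreal (2 powr \<alpha>)"
    by (intro add_mono increment_exp_bound[OF st tf]) (use c in auto)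
  also have "\<dots> = ennreal (2 * 2 powr \<alpha>)" by (simp add: ennreal_plus[symmetric] del: ennreal_plus)
  finally show ?thesis .
qed

section \<open>Oscillation of the normalized process\<close>

lemma f_continuous: "continuous_on {0<..} f"
  using continuous_on_minus[OF convex_on_continuous[of "{0<..}" "\<lambda>t. - f t"]] f_concave
  by (simp add: concave_on_def)

lemma G_continuous: "AE \<omega> in M. continuous_on {0<..} (\<lambda>t. G t \<omega>)"
  using cont unfolding G_def
  by eventually_elim (intro continuous_intros f_continuous, auto dest: f_pos)

text \<open>The exponential moments of all increments over dyadic subintervals of all the intervals
  are combined in one sum with weights \<open>4 powr (- k)\<close> for the level \<open>k\<close> and \<open>(n + 1) powr (- 2)\<close> for the
  interval \<open>n\<close>. The logarithms of the weights give the factors \<open>k + 1\<close> and \<open>1 + ln (n + 1)\<close>; the first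
  is absorbed by the geometric decay of the scale \<open>sqrt ((q n - p n) / 2 ^ k / f (p n))\<close>.\<close>
lemma oscillation_bound:
  fixes p q :: "nat \<Rightarrow> real"
  assumes p: "\<And>n. 0 < p n" and pq: "\<And>n. p n < q n" and qf: "\<And>n. q n \<le> f (q n)"
  shows "AE \<omega> in M. \<exists>K\<ge>0. \<forall>n. \<forall>t\<in>{p n..q n}.
    \<bar>G t \<omega> - G (q n) \<omega>\<bar> \<le> K * (1 + ln (real n + 1)) * sqrt ((q n - p n) / f (p n))"
proof -
  define d where "d n k i = p n + (q n - p n) * real i / 2 ^ k" for n k and i :: nat
  define \<theta> where "\<theta> n k i = sqrt (f (d n k (Suc i)) / (d n k (Suc i) - d n k i)) / 4" for n k i
  define Y where "Y n k i \<omega> = exp (\<theta> n k i * \<bar>G (d n k (Suc i)) \<omega> - G (d n k i) \<omega>\<bar>)" for n k i \<omega>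
  (* Level k contains 2^k increments with bounded exponential moments; the weights 4^(-k) make the sum over
     all levels integrable. *)
  define V where "V n \<omega> = (\<Sum>k. ennreal (1 / 4 ^ k) * (\<Sum>i<2 ^ k. ennreal (Y n k i \<omega>)))" for n \<omega>
  have d_pos: "0 < d n k i" for n k i
    using p[of n] pq[of n] by (auto simp: d_def intro!: add_pos_nonneg)
  have d_step: "d n k (Suc i) - d n k i = (q n - p n) / 2 ^ k" for n k i
    by (simp add: d_def field_simps)
  have d_lt: "d n k i < d n k (Suc i)" for n k i
    using d_step[of n k i] pq[of n] by (smt (verit) divide_pos_pos zero_less_power)
  have d_ge: "p n \<le> d n k i" for n k i
    using pq[of n] by (simp add: d_def)
  have d_le: "d n k i \<le> q n" if "i \<le> 2 ^ k" for n k i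
  proof -
    have "real i / 2 ^ k \<le> 1"
      using that by (simp add: divide_le_eq_1)
    then have "(q n - p n) * (real i / 2 ^ k) \<le> (q n - p n) * 1"
      using pq[of n] by (intro mult_left_mono) auto
    then show ?thesis by (simp add: d_def)
  qed
  have d_f: "d n k i \<le> f (d n k i)" if "i \<le> 2 ^ k" for n k i
  proof -
    have "d n k i / f (d n k i) \<le> q n / f (q n)"
      by (rule ratio_mono[OF d_pos d_le[OF that]])
    also have "\<dots> \<le> 1"
      using qf[of n] f_pos[of "q n"] p[of n] pq[of n] by (simp add: divide_le_eq_1)
    finally show ?thesis using f_pos[OF d_pos, of n k i] by (simp add: divide_le_eq_1)
  qed
  note [measurable] = G_measurable[OF d_pos]
  have V_meas [measurable]: "V n \<in> borel_measurable M" for n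
    unfolding V_def[abs_def] Y_def by measurable
  have V_int: "(\<integral>\<^sup>+\<omega>. V n \<omega> \<partial>M) \<le> ennreal (4 * 2 powr \<alpha>)" for n
  proof -
    have "(\<integral>\<^sup>+\<omega>. V n \<omega> \<partial>M) = (\<Sum>k. ennreal (1 / 4 ^ k) * (\<Sum>i<2 ^ k. \<integral>\<^sup>+\<omega>. ennreal (Y n k i \<omega>) \<partial>M))"
      unfolding V_def Y_def
      by (subst nn_integral_suminf, measurable) (simp add: nn_integral_cmult nn_integral_sum del: sum_ennreal)
    also have "\<dots> \<le> (\<Sum>k. ennreal ((1/2) ^ k * (2 * 2 powr \<alpha>)))"
    proof (intro suminf_le)
      fix k
      have "(\<Sum>i<2 ^ k. \<integral>\<^sup>+\<omega>. ennreal (Y n k i \<omega>) \<partial>M) \<le> (\<Sum>i<(2 ^ k :: nat). ennreal (2 * 2 powr \<alpha>))"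
        unfolding Y_def \<theta>_def
        by (intro sum_mono increment_exp_abs_bound d_pos d_lt d_f) auto
      also have "\<dots> = ennreal (2 ^ k * (2 * 2 powr \<alpha>))"
        by (subst sum_ennreal) simp_all
      finally have "ennreal (1 / 4 ^ k) * (\<Sum>i<2 ^ k. \<integral>\<^sup>+\<omega>. ennreal (Y n k i \<omega>) \<partial>M)
          \<le> ennreal (1 / 4 ^ k) * ennreal (2 ^ k * (2 * 2 powr \<alpha>))"
        by (intro mult_left_mono) auto
      also have "\<dots> = ennreal (1 / 4 ^ k * (2 ^ k * (2 * 2 powr \<alpha>)))"
        by (rule ennreal_mult[symmetric]) auto
      also have "1 / 4 ^ k * (2 ^ k * (2 * 2 powr \<alpha>)) = (1/2) ^ k * (2 * 2 powr \<alpha>)"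
        using power_mult_distrib[of "2::real" 2 k] by (simp add: power_one_over divide_simps)
      finally show "ennreal (1 / 4 ^ k) * (\<Sum>i<2 ^ k. \<integral>\<^sup>+\<omega>. ennreal (Y n k i \<omega>) \<partial>M)
          \<le> ennreal ((1/2) ^ k * (2 * 2 powr \<alpha>))" .
    qed auto
    also have "\<dots> = ennreal (\<Sum>k. (1/2) ^ k * (2 * 2 powr \<alpha>))"
      by (intro suminf_ennreal2 summable_mult2 summable_geometric) auto
    also have "(\<Sum>k. (1/2) ^ k * (2 * 2 powr \<alpha>)) = 4 * 2 powr \<alpha>"
      by (subst suminf_mult2[symmetric]) (auto simp: suminf_geometric)
    finally show ?thesis .
  qed
  have "summable (\<lambda>n. 1 / (real n + 1)\<^sup>2)"
    using summable_Suc_iff[of "\<lambda>n. inverse (real n ^ 2)"] inverse_power_summable[of 2]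
    by (simp add: inverse_eq_divide add.commute)
  then have "AE \<omega> in M. \<exists>S\<ge>1. \<forall>n. ennreal (1 / (real n + 1)\<^sup>2) * V n \<omega> \<le> ennreal S"
    by (intro AE_bounded_by_weights[OF V_meas V_int]) auto
  with G_continuous show ?thesis
  proof eventually_elim
    case (elim \<omega>)
    from elim(2) obtain S where S: "1 \<le> S" and SV: "\<And>n. ennreal (1 / (real n + 1)\<^sup>2) * V n \<omega> \<le> ennreal S"
      by blast
    define L where "L = ln S"
    have L: "0 \<le> L" using S by (simp add: L_def)
    (* The ratio by which the scale of the increments shrinks from one dyadic level to the next. *)
    define r where "r = sqrt (1 / 2 :: real)"
    have r: "0 < r" "r < 1" by (simp_all add: r_def real_sqrt_lt_1_iff)
    define K where "K = 4 * (L + 2) / (1 - r)\<^sup>2"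
    have "\<bar>G t \<omega> - G (q n) \<omega>\<bar> \<le> K * (1 + ln (real n + 1)) * sqrt ((q n - p n) / f (p n))"
      if t: "t \<in> {p n..q n}" for n t
    proof -
      define l where "l = ln (real n + 1)"
      have l: "0 \<le> l" by (simp add: l_def)
      define B where "B = 4 * (L + 2) * (1 + l) * sqrt ((q n - p n) / f (p n))"
      have B: "0 \<le> B" using L l pq[of n] f_pos[OF p, of n] by (simp add: B_def)
      have c_sums: "(\<lambda>k. B * (of_nat (Suc k) * r ^ k)) sums (B * (1 / (1 - r)\<^sup>2))"
        by (intro sums_mult geometric_deriv_sums) (use r in auto)
      have "\<bar>G t \<omega> - G (q n) \<omega>\<bar> \<le> (\<Sum>k. B * (of_nat (Suc k) * r ^ k))"
      proof (rule dyadic_chaining[OF pq _ _ sums_summable[OF c_sums] _ t])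
        show "continuous_on {p n..q n} (\<lambda>t. G t \<omega>)"
          by (rule continuous_on_subset[OF elim(1)]) (use p[of n] in auto)
        show "0 \<le> B * (of_nat (Suc k) * r ^ k)" for k
          using B r by simp
        fix k i :: nat assume i: "i < 2 ^ k"
        let ?v = "d n k (Suc i)" and ?u = "d n k i"
        let ?D = "\<bar>G ?v \<omega> - G ?u \<omega>\<bar>"
        have th: "0 < \<theta> n k i"
          using d_lt[of n k i] f_pos[OF d_pos, of n k "Suc i"] by (simp add: \<theta>_def)
        have "ennreal (1 / 4 ^ k) * ennreal (Y n k i \<omega>) \<le> ennreal (1 / 4 ^ k) * (\<Sum>i<2 ^ k. ennreal (Y n k i \<omega>))"
          using i by (intro mult_left_mono member_le_sum) auto
        also have "\<dots> \<le> V n \<omega>"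
          unfolding V_def using sum_le_suminf[of "\<lambda>k. ennreal (1 / 4 ^ k) * (\<Sum>i<2 ^ k. ennreal (Y n k i \<omega>))" "{k}"]
          by simp
        finally have "ennreal (1 / (real n + 1)\<^sup>2) * (ennreal (1 / 4 ^ k) * ennreal (Y n k i \<omega>)) \<le> ennreal S"
          using SV[of n] by (meson mult_left_mono order_trans zero_le)
        then have "1 / (real n + 1)\<^sup>2 * (1 / 4 ^ k * Y n k i \<omega>) \<le> S"
          using S by (simp add: ennreal_mult[symmetric] Y_def)
        then have "Y n k i \<omega> \<le> S * ((real n + 1)\<^sup>2 * 4 ^ k)"
          by (simp add: field_simps)
        then have "\<theta> n k i * ?D \<le> ln (S * ((real n + 1)\<^sup>2 * 4 ^ k))"
          unfolding Y_def using S by (subst ln_ge_iff) auto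
        also have "\<dots> = L + (2 * l + real k * ln 4)"
          using S by (simp add: ln_mult ln_realpow L_def l_def)
        also have "\<dots> \<le> L + (2 * l + real k * 2)"
        proof -
          have "ln (4::real) = 2 * ln 2" using ln_realpow[of 2 2] by simp
          then have "ln (4::real) \<le> 2" using ln_le_minus_one[of 2] by simp
          then show ?thesis by (intro add_left_mono mult_left_mono) auto
        qed
        also have "\<dots> \<le> (L + 2) * (1 + l) * real (Suc k)"
        proof -
          have "0 \<le> L * real k" "0 \<le> L * l" "0 \<le> l * real k" "0 \<le> L * l * real k" using L l by auto
          then show ?thesis by (simp add: algebra_simps)
        qed
        finally have "?D \<le> 1 / \<theta> n k i * ((L + 2) * (1 + l) * real (Suc k))"
          using th by (simp add: field_simps)
        also have "\<dots> \<le> 4 * (sqrt ((q n - p n) / f (p n)) * r ^ k) * ((L + 2) * (1 + l) * real (Suc k))"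
        proof (rule mult_right_mono)
          have "1 / \<theta> n k i = 4 * sqrt ((?v - ?u) / f ?v)"
            by (simp add: \<theta>_def real_sqrt_divide)
          also have "\<dots> \<le> 4 * sqrt ((?v - ?u) / f (p n))"
            using f_mono[OF p d_ge, of n k "Suc i"] f_pos[OF p, of n] d_lt[of n k i]
            by (intro mult_left_mono real_sqrt_le_mono divide_left_mono) auto
          also have "(?v - ?u) / f (p n) = (q n - p n) / f (p n) * (1/2) ^ k"
            by (simp add: d_step power_one_over)
          also have "sqrt \<dots> = sqrt ((q n - p n) / f (p n)) * r ^ k"
            by (simp only: real_sqrt_mult real_sqrt_power r_def)
          finally show "1 / \<theta> n k i \<le> 4 * (sqrt ((q n - p n) / f (p n)) * r ^ k)" .
        qed (use L l in simp)
        also have "\<dots> = B * (of_nat (Suc k) * r ^ k)"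
          by (simp add: B_def algebra_simps)
        finally show "\<bar>G (p n + (q n - p n) * real (Suc i) / 2 ^ k) \<omega> - G (p n + (q n - p n) * real i / 2 ^ k) \<omega>\<bar>
            \<le> B * (of_nat (Suc k) * r ^ k)"
          unfolding d_def .
      qed
      also have "\<dots> = B * (1 / (1 - r)\<^sup>2)" using c_sums by (rule sums_unique[symmetric])
      also have "\<dots> = K * (1 + ln (real n + 1)) * sqrt ((q n - p n) / f (p n))"
        by (simp add: K_def B_def l_def)
      finally show ?thesis .
    qed
    moreover have "0 \<le> K" using L by (simp add: K_def)
    ultimately show ?case by blast
  qed
qed

section \<open>Joint law of the process and its limit\<close>

lemma ratio_tendsto_0: "((\<lambda>t. t / f t) \<longlongrightarrow> 0) (at_right 0)"
proof (rule tendsto_sandwich[OF _ _ tendsto_const])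
  show "((\<lambda>t. C * t powr \<gamma>) \<longlongrightarrow> 0) (at_right 0)"
    using ratio_consts by real_asymp
  show "\<forall>\<^sub>F t in at_right 0. t / f t \<le> C * t powr \<gamma>"
    using eventually_at_right_real[OF ratio_consts(3)]
    by eventually_elim (auto intro: ratio_bound)
  show "\<forall>\<^sub>F t in at_right 0. 0 \<le> t / f t"
    using eventually_at_right_less[of 0] by eventually_elim (auto simp: f_pos less_imp_le)
qed

lemma AE_G_nonneg: "0 < t \<Longrightarrow> AE \<omega> in M. 0 \<le> G t \<omega>"
  using Z_nonneg[of t] f_pos[of t] by (auto simp: G_def elim!: eventually_mono)

text \<open>The transform of \<open>(G s, Z t)\<close> converges as \<open>s\<close> tends to 0 because \<open>s / f s\<close> does, and dominated
  convergence identifies the limit.\<close>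
lemma laplace_limit:
  assumes \<xi> [measurable]: "\<xi> \<in> borel_measurable M"
    and lim: "AE \<omega> in M. ((\<lambda>t. G t \<omega>) \<longlongrightarrow> \<xi> \<omega>) (at_right 0)"
    and t: "0 < t" and ab: "0 \<le> a" "0 \<le> b"
  shows "(\<integral>\<^sup>+\<omega>. exp (- (a * \<xi> \<omega> + b * Z t \<omega>)) \<partial>M) = ennreal (((1 + b * t) * (1 + a) + b * f t) powr (- \<alpha>))"
proof -
  define s where "s n = t / real (n + 2)" for n
  have s: "0 < s n" "s n < t" for n
    using t by (auto simp: s_def divide_less_eq)
  have s0: "s \<longlonglongrightarrow> 0"
    unfolding s_def[abs_def] by real_asymp
  then have s_lim: "filterlim s (at_right 0) sequentially"
    using s by (auto intro!: filterlim_at_withinI)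
  note [measurable] = G_measurable[OF s(1)] Z_measurable[OF t]
  let ?P = "\<lambda>n. 1 + a * (s n / f (s n) + 1) + b * (t + f t) + a * b * (s n / f (s n) + 1) * (t - s n)"
  have P: "(\<integral>\<^sup>+\<omega>. exp (- (a * G (s n) \<omega> + b * Z t \<omega>)) \<partial>M) = ennreal (?P n powr (- \<alpha>))" for n
  proof -
    have "0 < f (s n)" using f_pos s by simp
    then show ?thesis
      using laplace_two_nn[OF s, of "a / f (s n)" b n] ab by (simp add: G_def field_simps)
  qed
  have "(\<lambda>n. \<integral>\<^sup>+\<omega>. exp (- (a * G (s n) \<omega> + b * Z t \<omega>)) \<partial>M) \<longlonglongrightarrow> (\<integral>\<^sup>+\<omega>. exp (- (a * \<xi> \<omega> + b * Z t \<omega>)) \<partial>M)"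
  proof (rule nn_integral_dominated_convergence[where w="\<lambda>_. 1"])
    show "AE \<omega> in M. ennreal (exp (- (a * G (s n) \<omega> + b * Z t \<omega>))) \<le> 1" for n
      using AE_G_nonneg[OF s(1)[of n]] Z_nonneg[OF t]
    proof eventually_elim
      case (elim \<omega>)
      with ab have "0 \<le> a * G (s n) \<omega> + b * Z t \<omega>" by simp
      then show ?case by simp
    qed
    show "AE \<omega> in M. (\<lambda>n. ennreal (exp (- (a * G (s n) \<omega> + b * Z t \<omega>)))) \<longlonglongrightarrow> ennreal (exp (- (a * \<xi> \<omega> + b * Z t \<omega>)))"
      using lim
    proof eventually_elim
      case (elim \<omega>)
      show ?case
        by (intro tendsto_intros filterlim_compose[OF elim s_lim])
    qed
  qed (auto simp: emeasure_space_1)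
  moreover have "(\<lambda>n. ennreal (?P n powr (- \<alpha>))) \<longlonglongrightarrow> ennreal (((1 + b * t) * (1 + a) + b * f t) powr (- \<alpha>))"
  proof -
    have "?P \<longlonglongrightarrow> 1 + a * (0 + 1) + b * (t + f t) + a * b * (0 + 1) * (t - 0)"
      by (intro tendsto_intros filterlim_compose[OF ratio_tendsto_0 s_lim] s0)
    also have "1 + a * (0 + 1) + b * (t + f t) + a * b * (0 + 1) * (t - 0) = (1 + b * t) * (1 + a) + b * f t"
      by (simp add: algebra_simps)
    finally have lim_P: "?P \<longlonglongrightarrow> (1 + b * t) * (1 + a) + b * f t" .
    have "1 * 1 + 0 \<le> (1 + b * t) * (1 + a) + b * f t"
      using ab t f_pos[OF t] by (intro add_mono mult_mono) auto
    then show ?thesis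
      by (intro tendsto_ennrealI tendsto_powr lim_P tendsto_const) auto
  qed
  ultimately show ?thesis
    unfolding P by (rule LIMSEQ_unique)
qed

text \<open>The coefficient \<open>a = \<theta> * f t / (1 - t * \<theta>)\<close> of \<open>\<xi>\<close> is the one that cancels \<open>f t\<close> from
  the transform at \<open>(a, - \<theta>)\<close>, which becomes \<open>(1 - t * \<theta>) powr (- \<alpha>)\<close>. Its parameters have opposite
  signs, so one application of \<open>laplace_extension\<close> suffices: in the variable \<open>Z t\<close> when
  \<open>\<theta>\<close> is nonnegative, in \<open>\<xi>\<close> otherwise.\<close>
lemma centred_exp_moment:
  assumes \<xi> [measurable]: "\<xi> \<in> borel_measurable M"
    and lim: "AE \<omega> in M. ((\<lambda>t. G t \<omega>) \<longlongrightarrow> \<xi> \<omega>) (at_right 0)"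
    and pos: "AE \<omega> in M. 0 \<le> \<xi> \<omega>"
    and t: "0 < t" and \<theta>: "t * \<theta> < 1"
  shows "(\<integral>\<^sup>+\<omega>. exp (\<theta> * Z t \<omega> - \<theta> * f t / (1 - t * \<theta>) * \<xi> \<omega>) \<partial>M) = ennreal ((1 - t * \<theta>) powr (- \<alpha>))"
proof -
  note [measurable] = Z_measurable[OF t]
  have ft: "0 < f t" using t by (rule f_pos)
  define a where "a = \<theta> * f t / (1 - t * \<theta>)"
  have a_eq: "a * (1 - t * \<theta>) = \<theta> * f t" using \<theta> by (simp add: a_def)
  show ?thesis
  proof (cases "0 \<le> \<theta>")
    case True
    then have a: "0 \<le> a" using ft \<theta> by (simp add: a_def)
    let ?A = "1 + a" and ?B = "t * (1 + a) + f t"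
    have AB: "0 < ?A" "0 < ?B" using a ft t by (auto intro!: add_nonneg_pos)
    have eq: "?A + ?B * r = (1 + r * t) * (1 + a) + r * f t" for r by (simp add: algebra_simps)
    have P: "?A + ?B * (- \<theta>) = 1 - t * \<theta>" using a_eq by (simp add: algebra_simps)
    have "(\<integral>\<^sup>+\<omega>. exp (- a * \<xi> \<omega>) * exp (- (- \<theta>) * Z t \<omega>) \<partial>M) = ennreal ((?A + ?B * (- \<theta>)) powr (- \<alpha>))"
      by (rule laplace_extension[OF \<alpha>_pos AB])
         (use P \<theta> Z_nonneg[OF t] laplace_limit[OF \<xi> lim t a] in \<open>auto simp: eq exp_add[symmetric] algebra_simps\<close>)
    then show ?thesis unfolding P a_def[symmetric] by (simp add: exp_add[symmetric] algebra_simps)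
  next
    case False
    define b where "b = - \<theta>"
    have b: "0 < b" using False by (simp add: b_def)
    let ?A = "1 + b * t + b * f t" and ?B = "1 + b * t"
    have AB: "0 < ?A" "0 < ?B" using b ft t by (auto intro!: add_pos_nonneg)
    have eq: "?A + ?B * r = (1 + b * t) * (1 + r) + b * f t" for r by (simp add: algebra_simps)
    have P: "?A + ?B * a = 1 - t * \<theta>" using a_eq by (simp add: b_def algebra_simps)
    have "(\<integral>\<^sup>+\<omega>. exp (- b * Z t \<omega>) * exp (- a * \<xi> \<omega>) \<partial>M) = ennreal ((?A + ?B * a) powr (- \<alpha>))"
      by (rule laplace_extension[OF \<alpha>_pos AB])
         (use P \<theta> pos b laplace_limit[OF \<xi> lim t _ less_imp_le[OF b]] in \<open>auto simp: eq exp_add[symmetric] algebra_simps\<close>)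
    then show ?thesis unfolding P a_def[symmetric] by (simp add: b_def exp_add[symmetric] algebra_simps)
  qed
qed

lemma limit_gamma:
  assumes \<xi> [measurable]: "\<xi> \<in> borel_measurable M"
    and lim: "AE \<omega> in M. ((\<lambda>t. G t \<omega>) \<longlongrightarrow> \<xi> \<omega>) (at_right 0)"
    and pos: "AE \<omega> in M. 0 \<le> \<xi> \<omega>"
  shows "distributed M lborel \<xi> (\<lambda>x. ennreal (gamma_density \<alpha> x))"
proof (rule distributed_gamma_of_laplace[OF prob_space_axioms \<alpha>_pos \<xi> pos])
  show "(\<integral>\<^sup>+\<omega>. exp (- s * \<xi> \<omega>) \<partial>M) = ennreal ((1 + s) powr (- \<alpha>))" if "0 \<le> s" for s
    using laplace_limit[OF \<xi> lim, of 1 s 0] that by simp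
qed

section \<open>Convergence at zero\<close>

lemma eventually_mesh_ratio_le:
  assumes "0 < \<beta>"
  shows "\<forall>\<^sub>F n in sequentially. mesh \<beta> n / f (mesh \<beta> n) \<le> C * mesh \<beta> n powr \<gamma>"
  using order_tendstoD(2)[OF mesh_tendsto_0[OF assms] ratio_consts(3)]
  by eventually_elim (auto intro!: ratio_bound simp: mesh_pos)

lemma eventually_mesh_le_f:
  assumes "0 < \<beta>"
  shows "\<forall>\<^sub>F n in sequentially. mesh \<beta> n \<le> f (mesh \<beta> n)"
proof -
  have "filterlim (mesh \<beta>) (at_right 0) sequentially"
    using mesh_tendsto_0[OF assms] by (intro filterlim_at_withinI) (auto simp: mesh_pos)
  then have "\<forall>\<^sub>F n in sequentially. mesh \<beta> n / f (mesh \<beta> n) < 1"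
    by (intro order_tendstoD(2)[OF filterlim_compose[OF ratio_tendsto_0]]) auto
  then show ?thesis
  proof eventually_elim
    case (elim n)
    then show ?case using f_pos[OF mesh_pos, of \<beta> n] by (simp add: divide_less_eq)
  qed
qed

text \<open>The bound \<open>oscillation_bound\<close> for the cells of the mesh, rewritten with the help of
  \<open>(q - p) / f p = (q / p - 1) * (p / f p)\<close>. It applies from the point on where \<open>t \<le> f t\<close>.\<close>
lemma mesh_oscillation:
  assumes \<beta>: "0 < \<beta>"
  shows "AE \<omega> in M. \<exists>K\<ge>0. \<forall>\<^sub>F n in sequentially. \<forall>t\<in>{mesh \<beta> (Suc n)..mesh \<beta> n}.
    \<bar>G t \<omega> - G (mesh \<beta> n) \<omega>\<bar> \<le> K * mesh_defect \<beta> n * sqrt (mesh \<beta> n / f (mesh \<beta> n))"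
proof -
  obtain N where N: "\<And>n. N \<le> n \<Longrightarrow> mesh \<beta> n \<le> f (mesh \<beta> n)"
    using eventually_mesh_le_f[OF \<beta>] by (auto simp: eventually_sequentially)
  have "AE \<omega> in M. \<exists>K\<ge>0. \<forall>n. \<forall>t\<in>{mesh \<beta> (Suc (n + N))..mesh \<beta> (n + N)}.
    \<bar>G t \<omega> - G (mesh \<beta> (n + N)) \<omega>\<bar> \<le> K * (1 + ln (real n + 1)) *
      sqrt ((mesh \<beta> (n + N) - mesh \<beta> (Suc (n + N))) / f (mesh \<beta> (Suc (n + N))))"
    by (rule oscillation_bound) (auto simp: mesh_pos mesh_less[OF \<beta>] N)
  then show ?thesis
  proof eventually_elim
    case (elim \<omega>)
    then obtain K where K: "0 \<le> K" and *: "\<And>n t. t \<in> {mesh \<beta> (Suc (n + N))..mesh \<beta> (n + N)} \<Longrightarrow>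
      \<bar>G t \<omega> - G (mesh \<beta> (n + N)) \<omega>\<bar> \<le> K * (1 + ln (real n + 1)) *
      sqrt ((mesh \<beta> (n + N) - mesh \<beta> (Suc (n + N))) / f (mesh \<beta> (Suc (n + N))))"
      by blast
    have "\<bar>G t \<omega> - G (mesh \<beta> n) \<omega>\<bar> \<le> K * mesh_defect \<beta> n * sqrt (mesh \<beta> n / f (mesh \<beta> n))"
      if n: "N \<le> n" and t: "t \<in> {mesh \<beta> (Suc n)..mesh \<beta> n}" for n t
    proof -
      let ?p = "mesh \<beta> (Suc n)" and ?q = "mesh \<beta> n"
      have pq: "0 < ?p" "?p < ?q" using mesh_pos mesh_less[OF \<beta>] by auto
      have fp: "0 < f ?p" "0 < f ?q" using pq by (auto intro!: f_pos)
      have "\<bar>G t \<omega> - G ?q \<omega>\<bar> \<le> K * (1 + ln (real (n - N) + 1)) * sqrt ((?q - ?p) / f ?p)"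
        using *[of t "n - N"] n t by simp
      also have "\<dots> \<le> K * (1 + ln (real n + 1)) * sqrt ((?q / ?p - 1) * (?q / f ?q))"
      proof (intro mult_mono real_sqrt_le_mono)
        have "(?q - ?p) / f ?p = (?q / ?p - 1) * (?p / f ?p)"
          using pq fp by (simp add: field_simps)
        also have "\<dots> \<le> (?q / ?p - 1) * (?q / f ?q)"
          using pq by (intro mult_left_mono ratio_mono) (auto simp: le_divide_eq)
        finally show "(?q - ?p) / f ?p \<le> (?q / ?p - 1) * (?q / f ?q)" .
      qed (use K pq fp in \<open>auto intro!: mult_nonneg_nonneg add_nonneg_nonneg\<close>)
      also have "\<dots> = K * mesh_defect \<beta> n * sqrt (?q / f ?q)"
        by (simp only: mesh_defect_def real_sqrt_mult mult.assoc)
      finally show ?thesis .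
    qed
    then have "\<forall>\<^sub>F n in sequentially. \<forall>t\<in>{mesh \<beta> (Suc n)..mesh \<beta> n}.
        \<bar>G t \<omega> - G (mesh \<beta> n) \<omega>\<bar> \<le> K * mesh_defect \<beta> n * sqrt (mesh \<beta> n / f (mesh \<beta> n))"
      unfolding eventually_sequentially by blast
    with K show ?case by blast
  qed
qed

text \<open>The oscillations over the cells of a mesh are summable, because the ratio \<open>t / f t\<close> is bounded by a
  power of \<open>t\<close>. Any exponent between 0 and 1 serves; here it is one half.\<close>
lemma G_converges: "AE \<omega> in M. \<exists>l. ((\<lambda>t. G t \<omega>) \<longlongrightarrow> l) (at_right 0)"
proof -
  let ?T = "mesh (1/2)" and ?e = "mesh_defect (1/2)"
  have T: "?T \<longlonglongrightarrow> 0" "\<And>n. ?T (Suc n) \<le> ?T n" "\<And>n. 0 < ?T n"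
    using mesh_tendsto_0[of "1/2"] mesh_less[of "1/2"] by (auto simp: mesh_pos less_imp_le)
  show ?thesis
    using mesh_oscillation[of "1/2", simplified]
  proof eventually_elim
    case (elim \<omega>)
    then obtain K where K: "0 \<le> K" and osc: "\<forall>\<^sub>F n in sequentially. \<forall>t\<in>{?T (Suc n)..?T n}.
        \<bar>G t \<omega> - G (?T n) \<omega>\<bar> \<le> K * ?e n * sqrt (?T n / f (?T n))"
      by blast
    define u where "u n = K * sqrt C * ?T n powr (\<gamma> / 2)" for n
    have "\<forall>\<^sub>F n in sequentially. ?e n < 1"
      by (rule order_tendstoD(2)[OF mesh_defect_tendsto_0]) auto
    then have osc': "\<forall>\<^sub>F n in sequentially. \<forall>t\<in>{?T (Suc n)..?T n}. \<bar>G t \<omega> - G (?T n) \<omega>\<bar> \<le> u n"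
      using osc eventually_mesh_ratio_le[of "1/2", simplified]
    proof eventually_elim
      case (elim n)
      have "K * ?e n * sqrt (?T n / f (?T n)) \<le> K * 1 * sqrt (C * ?T n powr \<gamma>)"
        using elim K mesh_pos[of "1/2" n] f_pos[OF mesh_pos, of "1/2" n] mesh_defect_nonneg[of "1/2" n]
        by (intro mult_mono real_sqrt_le_mono) auto
      also have "\<dots> = u n"
        using mesh_pos[of "1/2" n] by (simp add: u_def real_sqrt_mult powr_half_sqrt[symmetric] powr_powr)
      finally show ?case using elim by force
    qed
    have sum_u: "summable u"
    proof (rule summable_comparison_test_bigo)
      show "summable (\<lambda>n. norm (1 / (real n)\<^sup>2))"
        using inverse_power_summable[of 2, where 'a=real] by (simp add: inverse_eq_divide)
      show "u \<in> O(\<lambda>n. 1 / (real n)\<^sup>2)"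
        unfolding u_def[abs_def] using mesh_powr_bigo[of "1/2" "\<gamma> / 2"] ratio_consts
        by (cases "K = 0") (simp_all add: mult.assoc)
    qed
    have "summable (\<lambda>n. G (?T (Suc n)) \<omega> - G (?T n) \<omega>)"
    proof (rule summable_comparison_test_ev[OF _ sum_u])
      show "\<forall>\<^sub>F n in sequentially. norm (G (?T (Suc n)) \<omega> - G (?T n) \<omega>) \<le> u n"
        using osc' by eventually_elim (use T(2) in auto)
    qed
    then obtain s where "(\<lambda>n. \<Sum>i<n. G (?T (Suc i)) \<omega> - G (?T i) \<omega>) \<longlonglongrightarrow> s"
      by (auto simp: summable_def sums_def)
    then have "(\<lambda>n. (G (?T n) \<omega> - G (?T 0) \<omega>) + G (?T 0) \<omega>) \<longlonglongrightarrow> s + G (?T 0) \<omega>"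
      unfolding sum_lessThan_telescope[of "\<lambda>i. G (?T i) \<omega>"] by (rule tendsto_add[OF _ tendsto_const])
    then have l: "(\<lambda>n. G (?T n) \<omega>) \<longlonglongrightarrow> s + G (?T 0) \<omega>" by simp
    show ?case
      by (rule exI, rule tendsto_at_right_of_blocks[OF T osc' summable_LIMSEQ_zero[OF sum_u] l])
  qed
qed

lemma AE_limit_nonneg:
  assumes lim: "AE \<omega> in M. ((\<lambda>t. G t \<omega>) \<longlongrightarrow> \<xi> \<omega>) (at_right 0)"
  shows "AE \<omega> in M. 0 \<le> \<xi> \<omega>"
proof -
  have "AE \<omega> in M. \<forall>n. 0 \<le> G (mesh 1 n) \<omega>"
    using AE_G_nonneg[OF mesh_pos] by (simp add: AE_all_countable)
  with lim show ?thesis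
  proof eventually_elim
    case (elim \<omega>)
    have "filterlim (mesh 1) (at_right 0) sequentially"
      using mesh_tendsto_0[of 1] by (intro filterlim_at_withinI) (auto simp: mesh_pos)
    from filterlim_compose[OF elim(1) this] elim(2) show ?case
      by (intro tendsto_lowerbound[of _ _ sequentially]) auto
  qed
qed

lemma coupling_exists: "\<exists>\<xi>. gamma_coupling M \<alpha> f Z \<xi>"
proof
  let ?\<xi> = "\<lambda>\<omega>. lim (\<lambda>n. G (mesh 1 n) \<omega>)"
  have [measurable]: "G (mesh 1 n) \<in> borel_measurable M" for n
    by (rule G_measurable[OF mesh_pos])
  have \<xi>: "?\<xi> \<in> borel_measurable M" by measurable
  have lim: "AE \<omega> in M. ((\<lambda>t. G t \<omega>) \<longlongrightarrow> ?\<xi> \<omega>) (at_right 0)"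
    using G_converges
  proof eventually_elim
    case (elim \<omega>)
    then obtain l where l: "((\<lambda>t. G t \<omega>) \<longlongrightarrow> l) (at_right 0)" by blast
    have "filterlim (mesh 1) (at_right 0) sequentially"
      using mesh_tendsto_0[of 1] by (intro filterlim_at_withinI) (auto simp: mesh_pos)
    from filterlim_compose[OF l this] have "?\<xi> \<omega> = l" by (rule limI)
    with l show ?case by simp
  qed
  show "gamma_coupling M \<alpha> f Z ?\<xi>"
    unfolding gamma_coupling_def
    using limit_gamma[OF \<xi> lim AE_limit_nonneg[OF lim]] lim by (simp add: G_def)
qed

section \<open>The law of the iterated logarithm\<close>

text \<open>Nonnegativity at every rational time, extended by continuity of the paths.\<close>
lemma AE_Z_nonneg: "AE \<omega> in M. \<forall>t>0. 0 \<le> Z t \<omega>"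
proof -
  have "AE \<omega> in M. \<forall>r\<in>{r\<in>\<rat>. 0 < r}. 0 \<le> Z r \<omega>"
    by (subst AE_ball_countable) (auto intro: Z_nonneg countable_subset[OF _ countable_rat])
  with cont show ?thesis
  proof eventually_elim
    case (elim \<omega>)
    show ?case
    proof (intro allI impI)
      fix t :: real assume t: "0 < t"
      have "\<exists>r. r \<in> \<rat> \<and> t < r \<and> r < t + inverse (real (Suc n))" for n
        using Rats_dense_in_real[of t "t + inverse (real (Suc n))"] by auto
      then obtain r where r: "\<And>n. r n \<in> \<rat>" "\<And>n. t < r n" "\<And>n. r n < t + inverse (real (Suc n))"
        by metis
      have "r \<longlonglongrightarrow> t"
      proof (rule tendsto_sandwich[OF _ _ tendsto_const])
        show "(\<lambda>n. t + inverse (real (Suc n))) \<longlonglongrightarrow> t"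
          using tendsto_add[OF tendsto_const LIMSEQ_inverse_real_of_nat, of t] by simp
      qed (use r in \<open>auto intro!: always_eventually less_imp_le\<close>)
      then have "(\<lambda>n. Z (r n) \<omega>) \<longlonglongrightarrow> Z t \<omega>"
        using r(2) t by (intro continuous_on_tendsto_compose[OF elim(1)])
          (auto intro!: always_eventually intro: less_trans)
      moreover have "0 \<le> Z (r n) \<omega>" for n
        using elim(2) r(1,2)[of n] t by auto
      ultimately show "0 \<le> Z t \<omega>"
        by (intro tendsto_lowerbound[of _ _ sequentially]) auto
    qed
  qed
qed

text \<open>The exponential moments at \<open>\<theta> n\<close> and \<open>- \<theta> n\<close> bound the difference from above and from below. In
  both cases the coefficient of \<open>\<xi>\<close> differs from \<open>f (T n)\<close> by a relative error of the order of
  \<open>T n * \<theta> n\<close>, which is the last term of the bound. That term is not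
  negligible: for the best \<open>\<theta> n\<close> it equals the first one asymptotically.\<close>
lemma centred_deviation:
  fixes T \<theta> w :: "nat \<Rightarrow> real"
  assumes \<xi> [measurable]: "\<xi> \<in> borel_measurable M"
    and lim: "AE \<omega> in M. ((\<lambda>t. G t \<omega>) \<longlongrightarrow> \<xi> \<omega>) (at_right 0)"
    and T: "\<And>n. 0 < T n" and \<theta>: "\<And>n. 0 < \<theta> n" "\<And>n. T n * \<theta> n \<le> 1 / 2"
    and w: "\<And>n. 0 < w n" "summable w"
  shows "AE \<omega> in M. \<exists>S\<ge>1. \<forall>n. \<bar>Z (T n) \<omega> - f (T n) * \<xi> \<omega>\<bar>
    \<le> (ln S - ln (w n)) / \<theta> n + f (T n) * \<xi> \<omega> * (T n * \<theta> n / (1 - T n * \<theta> n))"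
proof -
  note [measurable] = Z_measurable[OF T]
  define E where "E \<sigma> n \<omega> = exp (\<sigma> * Z (T n) \<omega> - \<sigma> * f (T n) / (1 - T n * \<sigma>) * \<xi> \<omega>)" for \<sigma> n \<omega>
  have pos: "AE \<omega> in M. 0 \<le> \<xi> \<omega>" by (rule AE_limit_nonneg[OF lim])
  have E_int: "(\<integral>\<^sup>+\<omega>. E \<sigma> n \<omega> \<partial>M) \<le> ennreal (2 powr \<alpha>)" if "\<sigma> \<in> {\<theta> n, - \<theta> n}" for \<sigma> n
  proof -
    have "T n * \<sigma> \<le> 1 / 2"
      using that \<theta>(2)[of n] mult_pos_pos[OF T[of n] \<theta>(1)[of n]] by auto
    then have "(\<integral>\<^sup>+\<omega>. E \<sigma> n \<omega> \<partial>M) = ennreal ((1 - T n * \<sigma>) powr (- \<alpha>))"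
      unfolding E_def by (intro centred_exp_moment[OF \<xi> lim pos T]) simp
    also have "(1 - T n * \<sigma>) powr (- \<alpha>) \<le> (1 / 2) powr (- \<alpha>)"
      using \<open>T n * \<sigma> \<le> 1 / 2\<close> \<alpha>_pos by (intro powr_mono2') auto
    also have "(1 / 2) powr (- \<alpha>) = 2 powr \<alpha>" by (simp add: powr_minus powr_divide)
    finally show ?thesis by (simp add: ennreal_leI)
  qed
  have [measurable]: "E \<sigma> n \<in> borel_measurable M" for \<sigma> n
    unfolding E_def[abs_def] by measurable
  have "AE \<omega> in M. \<exists>S\<ge>1. \<forall>n. ennreal (w n) * (ennreal (E (\<theta> n) n \<omega>) + ennreal (E (- \<theta> n) n \<omega>)) \<le> ennreal S"
  proof (rule AE_bounded_by_weights[where K="2 powr \<alpha> + 2 powr \<alpha>"])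
    show "(\<integral>\<^sup>+\<omega>. ennreal (E (\<theta> n) n \<omega>) + ennreal (E (- \<theta> n) n \<omega>) \<partial>M) \<le> ennreal (2 powr \<alpha> + 2 powr \<alpha>)" for n
    proof -
      have "(\<integral>\<^sup>+\<omega>. ennreal (E (\<theta> n) n \<omega>) + ennreal (E (- \<theta> n) n \<omega>) \<partial>M)
          = (\<integral>\<^sup>+\<omega>. E (\<theta> n) n \<omega> \<partial>M) + (\<integral>\<^sup>+\<omega>. E (- \<theta> n) n \<omega> \<partial>M)"
        by (rule nn_integral_add) auto
      also have "\<dots> \<le> ennreal (2 powr \<alpha>) + ennreal (2 powr \<alpha>)"
        by (intro add_mono E_int) auto
      also have "\<dots> = ennreal (2 powr \<alpha> + 2 powr \<alpha>)"
        by (rule ennreal_plus[symmetric]) auto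
      finally show ?thesis .
    qed
  qed (use w in \<open>auto simp: less_imp_le\<close>)
  with pos show ?thesis
  proof eventually_elim
    case (elim \<omega>)
    then obtain S where S: "1 \<le> S" and
      SE: "\<And>n. ennreal (w n) * (ennreal (E (\<theta> n) n \<omega>) + ennreal (E (- \<theta> n) n \<omega>)) \<le> ennreal S" by blast
    have "\<bar>Z (T n) \<omega> - f (T n) * \<xi> \<omega>\<bar>
      \<le> (ln S - ln (w n)) / \<theta> n + f (T n) * \<xi> \<omega> * (T n * \<theta> n / (1 - T n * \<theta> n))" for n
    proof -
      let ?z = "Z (T n) \<omega>" and ?m = "f (T n) * \<xi> \<omega>" and ?\<theta> = "\<theta> n" and ?e = "T n * \<theta> n"
      let ?R = "ln S - ln (w n)"
      have e: "0 < ?e" "?e \<le> 1 / 2" using T \<theta> by auto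
      have m: "0 \<le> ?m" using elim(1) f_pos[OF T, of n] by simp
      have "w n * (E ?\<theta> n \<omega> + E (- ?\<theta>) n \<omega>) \<le> S"
        using SE[of n] S w(1)[of n]
        by (simp add: ennreal_plus[symmetric] ennreal_mult[symmetric] E_def less_imp_le del: ennreal_plus)
      then have "E ?\<theta> n \<omega> + E (- ?\<theta>) n \<omega> \<le> S / w n"
        using w(1)[of n] by (simp add: field_simps)
      moreover have "0 < E \<sigma> n \<omega>" for \<sigma> by (simp add: E_def)
      ultimately have "E \<sigma> n \<omega> \<le> S / w n" if "\<sigma> \<in> {?\<theta>, - ?\<theta>}" for \<sigma>
        using that by (smt (verit) insert_iff singletonD)
      then have R: "\<sigma> * ?z - \<sigma> * f (T n) / (1 - T n * \<sigma>) * \<xi> \<omega> \<le> ?R" if "\<sigma> \<in> {?\<theta>, - ?\<theta>}" for \<sigma>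
        using that S w(1)[of n] ln_ge_iff[of "S / w n"] by (simp add: E_def ln_div)
      have "?\<theta> * (?z - ?m / (1 - ?e)) \<le> ?R"
        using R[of ?\<theta>] by (simp add: algebra_simps)
      then have "?z - ?m / (1 - ?e) \<le> ?R / ?\<theta>"
        using \<theta>(1)[of n] by (simp add: field_simps)
      moreover have "?m / (1 - ?e) - ?m = ?m * (?e / (1 - ?e))"
        using e by (simp add: field_simps)
      ultimately have upper: "?z - ?m \<le> ?R / ?\<theta> + ?m * (?e / (1 - ?e))" by linarith
      have "?\<theta> * (?m / (1 + ?e) - ?z) \<le> ?R"
        using R[of "- ?\<theta>"] by (simp add: algebra_simps)
      then have "?m / (1 + ?e) - ?z \<le> ?R / ?\<theta>"
        using \<theta>(1)[of n] by (simp add: field_simps)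
      moreover have "?m - ?m / (1 + ?e) = ?m * (?e / (1 + ?e))"
        using e by (simp add: field_simps)
      moreover have "?m * (?e / (1 + ?e)) \<le> ?m * (?e / (1 - ?e))"
        using e m by (intro mult_left_mono divide_left_mono) auto
      ultimately have "?m - ?z \<le> ?R / ?\<theta> + ?m * (?e / (1 - ?e))" by linarith
      with upper show ?thesis by linarith
    qed
    with S show ?case by blast
  qed
qed

text \<open>The choice \<open>\<theta> n = sqrt (ln n / \<beta>) / sqrt (x * f t * t)\<close> minimizes
  \<open>ln n / \<beta> / \<theta> + f t * t * x * \<theta>\<close>, that is, the bound of \<open>centred_deviation\<close> for the weights
  \<open>n powr (- 1 / \<beta>)\<close> when \<open>\<xi>\<close> equals \<open>x\<close>. For \<open>\<xi>\<close> close to \<open>x\<close> it is nearly optimal: the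
  constant \<open>sqrt x + \<xi> / sqrt x\<close> becomes \<open>2 * sqrt \<xi>\<close> at \<open>x = \<xi>\<close>.\<close>
lemma mesh_deviation:
  assumes \<xi> [measurable]: "\<xi> \<in> borel_measurable M"
    and lim: "AE \<omega> in M. ((\<lambda>t. G t \<omega>) \<longlongrightarrow> \<xi> \<omega>) (at_right 0)"
    and \<beta>: "0 < \<beta>" "\<beta> < 1" and x: "0 < x"
  shows "AE \<omega> in M. \<forall>A > (sqrt x + \<xi> \<omega> / sqrt x) / \<beta>. \<forall>\<^sub>F n in sequentially.
    \<bar>Z (mesh \<beta> n) \<omega> - f (mesh \<beta> n) * \<xi> \<omega>\<bar> \<le> A * sqrt (mesh \<beta> n * f (mesh \<beta> n) * (\<beta> * ln (real n)))"
proof -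
  let ?T = "mesh \<beta>"
  define F where "F n = f (?T n)" for n
  have F: "0 < F n" for n unfolding F_def by (rule f_pos[OF mesh_pos])
  define \<theta> where "\<theta> n = sqrt (ln (real n) / \<beta>) / sqrt (x * F n * ?T n)" for n
  (* The relative error in the expansion of the exponential moment, which tends to 0 since t / f t is
     bounded by a power of t. *)
  define e where "e n = ?T n * \<theta> n" for n
  have e_eq: "e n = sqrt (ln (real n) * (?T n / F n) / (\<beta> * x))" if "1 \<le> n" for n
  proof -
    have "?T n = sqrt (?T n * ?T n)" using mesh_pos[of \<beta> n] by simp
    then have "e n = sqrt (?T n * ?T n) * (sqrt (ln (real n) / \<beta>) / sqrt (x * F n * ?T n))"
      by (simp add: e_def \<theta>_def)
    also have "\<dots> = sqrt (?T n * ?T n * (ln (real n) / \<beta> / (x * F n * ?T n)))"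
      by (simp only: real_sqrt_mult real_sqrt_divide)
    also have "?T n * ?T n * (ln (real n) / \<beta> / (x * F n * ?T n)) = ln (real n) * (?T n / F n) / (\<beta> * x)"
      using mesh_pos[of \<beta> n] F[of n] x \<beta> by (simp add: field_simps)
    finally show ?thesis .
  qed
  have "(\<lambda>n. sqrt (C * (ln (real n) * ?T n powr \<gamma>) / (\<beta> * x))) \<longlonglongrightarrow> sqrt (C * 0 / (\<beta> * x))"
    using ratio_consts \<beta> x by (intro tendsto_intros mesh_powr_ln_tendsto_0) auto
  then have up: "(\<lambda>n. sqrt (C * (ln (real n) * ?T n powr \<gamma>) / (\<beta> * x))) \<longlonglongrightarrow> 0" by simp
  have e0: "e \<longlonglongrightarrow> 0"
  proof (rule tendsto_sandwich[OF _ _ tendsto_const up])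
    show "\<forall>\<^sub>F n in sequentially. 0 \<le> e n"
      using eventually_ge_at_top[of 1]
    proof eventually_elim
      case (elim n)
      then show ?case unfolding e_eq[OF elim] using mesh_pos[of \<beta> n] F[of n] x \<beta> by simp
    qed
    show "\<forall>\<^sub>F n in sequentially. e n \<le> sqrt (C * (ln (real n) * ?T n powr \<gamma>) / (\<beta> * x))"
      using eventually_ge_at_top[of 1] eventually_mesh_ratio_le[OF \<beta>(1)]
    proof eventually_elim
      case (elim n)
      have "ln (real n) * (?T n / F n) \<le> ln (real n) * (C * ?T n powr \<gamma>)"
        using elim by (intro mult_left_mono) (auto simp: F_def)
      then show ?case unfolding e_eq[OF elim(1)] using x \<beta>
        by (intro real_sqrt_le_mono divide_right_mono) (auto simp: ac_simps)
    qed
  qed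
  have "\<forall>\<^sub>F n in sequentially. e n \<le> 1 / 2 \<and> 2 \<le> n"
  proof -
    have "\<forall>\<^sub>F n in sequentially. e n < 1 / 2"
      by (rule order_tendstoD(2)[OF e0]) simp
    then show ?thesis
      using eventually_ge_at_top[of 2] by eventually_elim simp
  qed
  then obtain N where N: "\<And>n. N \<le> n \<Longrightarrow> e n \<le> 1 / 2 \<and> 2 \<le> n"
    unfolding eventually_sequentially by blast
  have "AE \<omega> in M. \<exists>S\<ge>1. \<forall>n. \<bar>Z (?T (n + N)) \<omega> - f (?T (n + N)) * \<xi> \<omega>\<bar>
    \<le> (ln S - ln (real (n + N) powr (- 1 / \<beta>))) / \<theta> (n + N)
        + f (?T (n + N)) * \<xi> \<omega> * (?T (n + N) * \<theta> (n + N) / (1 - ?T (n + N) * \<theta> (n + N)))"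
  proof (rule centred_deviation[OF \<xi> lim])
    fix n
    have n: "e (n + N) \<le> 1 / 2" "2 \<le> n + N" using N[of "n + N"] by auto
    show "0 < ?T (n + N)" by (rule mesh_pos)
    show "0 < \<theta> (n + N)" using n \<beta> x F[of "n + N"] mesh_pos[of \<beta> "n + N"] by (simp add: \<theta>_def)
    show "?T (n + N) * \<theta> (n + N) \<le> 1 / 2" using n by (simp add: e_def)
    show "0 < real (n + N) powr (- 1 / \<beta>)" using n by simp
    show "summable (\<lambda>n. real (n + N) powr (- 1 / \<beta>))"
      using summable_ignore_initial_segment[OF mesh_powr_summable[OF \<beta>], of N] by simp
  qed
  then show ?thesis
  proof eventually_elim
    case (elim \<omega>)
    then obtain S where S: "1 \<le> S" and
      dev: "\<And>n. \<bar>Z (?T (n + N)) \<omega> - f (?T (n + N)) * \<xi> \<omega>\<bar>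
        \<le> (ln S - ln (real (n + N) powr (- 1 / \<beta>))) / \<theta> (n + N)
          + f (?T (n + N)) * \<xi> \<omega> * (?T (n + N) * \<theta> (n + N) / (1 - ?T (n + N) * \<theta> (n + N)))"
      by blast
    define a where "a n = sqrt x * (ln S / ln (real n) + 1 / \<beta>) + \<xi> \<omega> / (\<beta> * sqrt x * (1 - e n))" for n
    have a_lim: "a \<longlonglongrightarrow> sqrt x * (0 + 1 / \<beta>) + \<xi> \<omega> / (\<beta> * sqrt x * (1 - 0))"
      unfolding a_def
    proof (intro tendsto_intros e0)
      show "(\<lambda>n. ln S / ln (real n)) \<longlonglongrightarrow> 0" by real_asymp
    qed (use \<beta> x in auto)
    show ?case
    proof (intro allI impI)
      fix A assume A: "(sqrt x + \<xi> \<omega> / sqrt x) / \<beta> < A"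
      have "sqrt x * (0 + 1 / \<beta>) + \<xi> \<omega> / (\<beta> * sqrt x * (1 - 0)) = (sqrt x + \<xi> \<omega> / sqrt x) / \<beta>"
        by (simp add: add_divide_distrib)
      with A have "\<forall>\<^sub>F n in sequentially. a n < A"
        by (intro order_tendstoD(2)[OF a_lim]) simp
      then show "\<forall>\<^sub>F n in sequentially.
        \<bar>Z (?T n) \<omega> - f (?T n) * \<xi> \<omega>\<bar> \<le> A * sqrt (?T n * f (?T n) * (\<beta> * ln (real n)))"
        using eventually_ge_at_top[of N]
      proof eventually_elim
        case (elim n)
        have n: "e n \<le> 1 / 2" "2 \<le> n" using N[OF elim(2)] by auto
        define l where "l = ln (real n)"
        have l: "0 < l" using n by (simp add: l_def)
        define u where "u = sqrt (F n * ?T n)"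
        have u: "0 < u" using F[of n] mesh_pos[of \<beta> n] by (simp add: u_def)
        have uu: "u * u = F n * ?T n" using F[of n] mesh_pos[of \<beta> n] by (simp add: u_def)
        define v where "v = sqrt l"
        have v: "0 < v" "v * v = l" using l by (auto simp: v_def)
        define b where "b = sqrt \<beta>"
        have b: "0 < b" "b * b = \<beta>" using \<beta> by (auto simp: b_def)
        define y where "y = sqrt x"
        have y: "0 < y" using x by (simp add: y_def)
        have th: "\<theta> n = v / b / (y * u)"
          by (simp add: \<theta>_def v_def b_def y_def u_def l_def real_sqrt_divide real_sqrt_mult)
        have Q: "sqrt (?T n * f (?T n) * (\<beta> * ln (real n))) = u * (b * v)"
          by (simp add: u_def b_def v_def l_def F_def real_sqrt_mult)
        have "ln (real n powr (- 1 / \<beta>)) = - l / \<beta>"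
          using n by (simp add: ln_powr l_def)
        then have "\<bar>Z (?T n) \<omega> - f (?T n) * \<xi> \<omega>\<bar> \<le> (ln S + l / \<beta>) / \<theta> n + F n * \<xi> \<omega> * (e n / (1 - e n))"
          using dev[of "n - N"] elim(2) \<beta> by (simp add: F_def e_def l_def)
        also have "(ln S + l / \<beta>) / \<theta> n = u * (b * v) * (y * (ln S / l + 1 / \<beta>))"
        proof -
          have "(ln S + l / \<beta>) = l * (ln S / l + 1 / \<beta>)" using l by (simp add: field_simps)
          then have "(ln S + l / \<beta>) / \<theta> n = v * v * (ln S / l + 1 / \<beta>) / (v / b / (y * u))"
            by (simp only: th v(2))
          moreover have "v * v * q / (v / b / (y * u)) = u * (b * v) * (y * q)" for q
            using v(1) b(1) y u by (simp add: field_simps)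
          ultimately show ?thesis by (simp only:)
        qed
        also have "F n * \<xi> \<omega> * (e n / (1 - e n)) = u * (b * v) * (\<xi> \<omega> / (\<beta> * y * (1 - e n)))"
        proof -
          have "F n * e n = u * u * \<theta> n" by (simp add: e_def uu)
          also have "\<dots> = u * (b * v) / (b * b * y)" using u b(1) v(1) y by (simp add: th field_simps)
          finally have "F n * e n = u * (b * v) / (\<beta> * y)" by (simp only: b(2))
          then have "F n * \<xi> \<omega> * (e n / (1 - e n)) = u * (b * v) / (\<beta> * y) * (\<xi> \<omega> / (1 - e n))"
            by (metis (no_types, opaque_lifting) mult.commute mult.left_commute times_divide_eq_right)
          then show ?thesis by simp
        qed
        also have "u * (b * v) * (y * (ln S / l + 1 / \<beta>)) + u * (b * v) * (\<xi> \<omega> / (\<beta> * y * (1 - e n)))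
            = u * (b * v) * a n"
          by (simp add: a_def l_def y_def distrib_left)
        also have "\<dots> \<le> u * (b * v) * A"
          using elim(1) u b v by (intro mult_left_mono) auto
        finally show ?case unfolding Q by (simp add: mult.commute)
      qed
    qed
  qed
qed

text \<open>On the cell below \<open>mesh \<beta> n\<close>, the distance from \<open>G t\<close> to \<open>\<xi>\<close> is at most the oscillation over the cell
  plus the deviation at its right endpoint; the former is negligible since
  \<open>mesh_defect \<beta> n\<close> tends to 0. The bound for \<open>G t - \<xi>\<close> carries over to square roots through
  \<open>\<bar>sqrt a - sqrt b\<bar> * (sqrt a + sqrt b) = \<bar>a - b\<bar>\<close>.\<close>
lemma lil_parametrized:
  assumes \<xi> [measurable]: "\<xi> \<in> borel_measurable M"
    and lim: "AE \<omega> in M. ((\<lambda>t. G t \<omega>) \<longlongrightarrow> \<xi> \<omega>) (at_right 0)"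
    and \<beta>: "0 < \<beta>" "\<beta> < 1" and x: "0 < x"
  shows "AE \<omega> in M. 0 < \<xi> \<omega> \<longrightarrow>
    (\<forall>\<kappa> > (sqrt x + \<xi> \<omega> / sqrt x) / (2 * \<beta> * sqrt (\<xi> \<omega>)). \<forall>\<^sub>F t in at_right 0.
      \<bar>sqrt (Z t \<omega>) - sqrt (f t * \<xi> \<omega>)\<bar> / sqrt (t * ln (ln (1 / t))) \<le> \<kappa>)"
  using lim AE_Z_nonneg mesh_oscillation[OF \<beta>(1)] mesh_deviation[OF \<xi> lim \<beta> x]
proof eventually_elim
  case (elim \<omega>)
  let ?T = "mesh \<beta>" and ?l = "\<xi> \<omega>"
  from elim(3) obtain K where K: "0 \<le> K" and osc: "\<forall>\<^sub>F n in sequentially. \<forall>t\<in>{?T (Suc n)..?T n}.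
      \<bar>G t \<omega> - G (?T n) \<omega>\<bar> \<le> K * mesh_defect \<beta> n * sqrt (?T n / f (?T n))"
    by blast
  show ?case
  proof (intro impI allI)
    fix \<kappa> assume l: "0 < ?l" and \<kappa>: "(sqrt x + ?l / sqrt x) / (2 * \<beta> * sqrt ?l) < \<kappa>"
    define A0 where "A0 = (sqrt x + ?l / sqrt x) / \<beta>"
    have A0: "0 < A0" using x l \<beta> by (simp add: A0_def add_pos_pos)
    have sl: "0 < sqrt ?l" using l by simp
    have "A0 < \<kappa> * (2 * sqrt ?l)"
      using \<kappa> sl \<beta> by (simp add: A0_def field_simps)
    then obtain A2 where A2: "A0 < A2" "A2 < \<kappa> * (2 * sqrt ?l)" using dense by blast
    obtain A where A: "A0 < A" "A < A2" using dense[OF A2(1)] by blast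
    have \<kappa>_pos: "0 < \<kappa>"
      using A0 A2 sl by (smt (verit) mult_nonpos_nonneg)
    (* A2 leaves room above the constant A of the deviation for the oscillation, and B leaves room below the
       limit 2 * sqrt \<xi> of the denominator; their quotient is the required \<kappa>. *)
    define B where "B = A2 / \<kappa>"
    have B: "0 < B" "B < 2 * sqrt ?l" using A0 A2 \<kappa>_pos by (simp_all add: B_def divide_less_eq mult.commute)
    (* The constant obtained on the n-th cell after comparing the scale at t with the scale at its left
       endpoint. *)
    define R where "R n = sqrt (?T n / ?T (Suc n)) * (K * mesh_defect \<beta> n / sqrt (\<beta> * ln (real n)) + A)" for n
    have R_lim: "R \<longlonglongrightarrow> sqrt 1 * (K * 0 * 0 + A)"
    proof -
      have "(\<lambda>n. 1 / sqrt (\<beta> * ln (real n))) \<longlonglongrightarrow> 0" using \<beta> by real_asymp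
      then have "(\<lambda>n. sqrt (?T n / ?T (Suc n)) * (K * mesh_defect \<beta> n * (1 / sqrt (\<beta> * ln (real n))) + A))
          \<longlonglongrightarrow> sqrt 1 * (K * 0 * 0 + A)"
        by (intro tendsto_intros mesh_ratio_tendsto_1 mesh_defect_tendsto_0 \<beta>)
      then show ?thesis unfolding R_def by simp
    qed
    have R_ev: "\<forall>\<^sub>F n in sequentially. R n < A2"
      by (rule order_tendstoD(2)[OF R_lim]) (use A in simp)
    have dev: "\<forall>\<^sub>F n in sequentially.
        \<bar>Z (?T n) \<omega> - f (?T n) * ?l\<bar> \<le> A * sqrt (?T n * f (?T n) * (\<beta> * ln (real n)))"
      using elim(4) A(1) unfolding A0_def by blast
    have "\<forall>\<^sub>F n in sequentially. \<forall>t\<in>{?T (Suc n)..?T n}.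
        sqrt (f t) * \<bar>G t \<omega> - ?l\<bar> \<le> A2 * sqrt (t * ln (ln (1 / t)))"
      using osc dev R_ev eventually_ge_at_top[of 2]
    proof eventually_elim
      case (elim n)
      show ?case
      proof
        fix t assume t: "t \<in> {?T (Suc n)..?T n}"
        let ?p = "?T (Suc n)" and ?q = "?T n"
        have p: "0 < ?p" and q: "0 < ?q" by (simp_all add: mesh_pos)
        have t_pos: "0 < t" using t p by simp
        define F where "F = sqrt (f ?q)"
        have F: "0 < F" "F * F = f ?q" using f_pos[OF q] by (simp_all add: F_def)
        define L where "L = \<beta> * ln (real n)"
        have L: "0 < L" using \<beta> elim(4) by (simp add: L_def)
        have "F * \<bar>G ?q \<omega> - ?l\<bar> = \<bar>Z ?q \<omega> - f ?q * ?l\<bar> / F"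
        proof -
          have "Z ?q \<omega> - f ?q * ?l = f ?q * (G ?q \<omega> - ?l)"
            using f_pos[OF q] by (simp add: G_def field_simps)
          then have "\<bar>Z ?q \<omega> - f ?q * ?l\<bar> = F * F * \<bar>G ?q \<omega> - ?l\<bar>"
            unfolding F(2) using f_pos[OF q] by (simp add: abs_mult)
          then show ?thesis using F(1) by simp
        qed
        also have "\<dots> \<le> A * sqrt (?q * f ?q * L) / F"
          using elim(2) F by (intro divide_right_mono) (auto simp: L_def)
        also have "\<dots> = A * (sqrt ?q * sqrt L)"
          using F(1) by (simp add: real_sqrt_mult F_def)
        finally have d: "F * \<bar>G ?q \<omega> - ?l\<bar> \<le> A * (sqrt ?q * sqrt L)" .
        have "F * \<bar>G t \<omega> - G ?q \<omega>\<bar> \<le> F * (K * mesh_defect \<beta> n * sqrt (?q / f ?q))"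
          using elim(1) t F by (intro mult_left_mono) auto
        also have "\<dots> = K * mesh_defect \<beta> n * sqrt ?q"
          using F(1) by (simp add: real_sqrt_divide F_def)
        finally have o: "F * \<bar>G t \<omega> - G ?q \<omega>\<bar> \<le> K * mesh_defect \<beta> n * sqrt ?q" .
        have "sqrt (f t) * \<bar>G t \<omega> - ?l\<bar> \<le> F * \<bar>G t \<omega> - ?l\<bar>"
          unfolding F_def using t t_pos by (intro mult_right_mono real_sqrt_le_mono f_mono) auto
        also have "\<dots> \<le> F * (\<bar>G t \<omega> - G ?q \<omega>\<bar> + \<bar>G ?q \<omega> - ?l\<bar>)"
          using F by (intro mult_left_mono) auto
        also have "\<dots> \<le> K * mesh_defect \<beta> n * sqrt ?q + A * (sqrt ?q * sqrt L)"
          using d o by (simp add: distrib_left)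
        also have "\<dots> = R n * (sqrt ?p * sqrt L)"
          using p q L by (simp add: R_def L_def[symmetric] real_sqrt_divide field_simps)
        also have "\<dots> \<le> A2 * (sqrt t * sqrt (ln (ln (1 / t))))"
        proof (intro mult_mono real_sqrt_le_mono)
          show "L \<le> ln (ln (1 / t))"
            unfolding L_def using t t_pos elim(4) \<beta> by (intro ln_ln_inverse_mesh) auto
        qed (use elim(3) t p L A0 A2(1) in auto)
        finally show "sqrt (f t) * \<bar>G t \<omega> - ?l\<bar> \<le> A2 * sqrt (t * ln (ln (1 / t)))"
          by (simp add: real_sqrt_mult)
      qed
    qed
    then have bound: "\<forall>\<^sub>F t in at_right 0. sqrt (f t) * \<bar>G t \<omega> - ?l\<bar> \<le> A2 * sqrt (t * ln (ln (1 / t)))"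
      by (rule eventually_at_right_of_blocks[OF mesh_tendsto_0[OF \<beta>(1)] less_imp_le[OF mesh_less[OF \<beta>(1)]] mesh_pos])
    have "((\<lambda>t. sqrt (G t \<omega>) + sqrt ?l) \<longlongrightarrow> sqrt ?l + sqrt ?l) (at_right 0)"
      by (intro tendsto_intros elim(1))
    then have denom: "\<forall>\<^sub>F t in at_right 0. B < sqrt (G t \<omega>) + sqrt ?l"
      by (rule order_tendstoD(1)) (use B in simp)
    have pos: "\<forall>\<^sub>F t in at_right 0. (0::real) < t * ln (ln (1 / t))"
      by real_asymp
    show "\<forall>\<^sub>F t in at_right 0. \<bar>sqrt (Z t \<omega>) - sqrt (f t * ?l)\<bar> / sqrt (t * ln (ln (1 / t))) \<le> \<kappa>"
      using bound denom pos eventually_at_right_less[of 0]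
    proof eventually_elim
      case (elim t)
      have G0: "0 \<le> G t \<omega>" using \<open>\<forall>t>0. 0 \<le> Z t \<omega>\<close> elim(4) f_pos[of t] by (simp add: G_def)
      have Z_eq: "Z t \<omega> = f t * G t \<omega>" using f_pos[OF elim(4)] by (simp add: G_def)
      let ?W = "\<bar>sqrt (Z t \<omega>) - sqrt (f t * ?l)\<bar>"
      have "\<bar>sqrt (G t \<omega>) - sqrt ?l\<bar> * (sqrt (G t \<omega>) + sqrt ?l) = \<bar>(sqrt (G t \<omega>) - sqrt ?l) * (sqrt (G t \<omega>) + sqrt ?l)\<bar>"
        using G0 l by (simp add: abs_mult)
      also have "(sqrt (G t \<omega>) - sqrt ?l) * (sqrt (G t \<omega>) + sqrt ?l) = G t \<omega> - ?l"
        using G0 l by (simp add: algebra_simps)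
      finally have diff: "\<bar>sqrt (G t \<omega>) - sqrt ?l\<bar> * (sqrt (G t \<omega>) + sqrt ?l) = \<bar>G t \<omega> - ?l\<bar>" .
      have "?W = \<bar>sqrt (f t) * (sqrt (G t \<omega>) - sqrt ?l)\<bar>"
        by (simp add: Z_eq real_sqrt_mult right_diff_distrib)
      then have W: "?W = sqrt (f t) * \<bar>sqrt (G t \<omega>) - sqrt ?l\<bar>"
        using f_pos[OF elim(4)] by (simp add: abs_mult)
      have "?W * B \<le> ?W * (sqrt (G t \<omega>) + sqrt ?l)"
        using elim(2) by (intro mult_left_mono) auto
      also have "\<dots> = sqrt (f t) * \<bar>G t \<omega> - ?l\<bar>"
        unfolding W by (simp only: mult.assoc diff)
      also have "\<dots> \<le> A2 * sqrt (t * ln (ln (1 / t)))" by (rule elim(1))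
      finally have "?W \<le> A2 * sqrt (t * ln (ln (1 / t))) / B"
        using B by (simp add: le_divide_eq)
      also have "\<dots> = \<kappa> * sqrt (t * ln (ln (1 / t)))"
        using A0 A2(1) \<kappa>_pos by (simp add: B_def)
      finally show ?case using elim(3) by (simp add: divide_le_eq)
    qed
  qed
qed

text \<open>All exponents \<open>1 - 1 / (m + 2)\<close> and all rational \<open>x\<close> are admitted simultaneously. For a given outcome,
  \<open>x\<close> is chosen between \<open>\<xi>\<close> and \<open>c\<^sup>2 * \<xi>\<close>, where \<open>c > 1\<close> is the square root of the constant \<open>\<kappa>\<close> to be
  reached; this costs one factor \<open>c\<close>, and an exponent above \<open>1 / c\<close> costs the other.\<close>
lemma lil_upper_bound:
  assumes coupling: "gamma_coupling M \<alpha> f Z \<xi>"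
  shows "AE \<omega> in M. Limsup (at_right 0)
    (\<lambda>t. ereal (\<bar>sqrt (Z t \<omega>) - sqrt (f t * \<xi> \<omega>)\<bar> / sqrt (t * ln (ln (1 / t))))) \<le> 1"
proof -
  have dist: "distributed M lborel \<xi> (\<lambda>x. ennreal (gamma_density \<alpha> x))"
    and lim: "AE \<omega> in M. ((\<lambda>t. G t \<omega>) \<longlongrightarrow> \<xi> \<omega>) (at_right 0)"
    using coupling by (simp_all add: gamma_coupling_def G_def)
  have \<xi>: "\<xi> \<in> borel_measurable M"
    using distributed_measurable[OF dist] by simp
  have pos: "AE \<omega> in M. 0 < \<xi> \<omega>"
    by (subst distributed_AE2[OF dist]) (auto simp: gamma_density_def)
  define b where "b m = 1 - 1 / real (Suc (Suc m))" for m
  have b: "0 < b m" "b m < 1" for m by (simp_all add: b_def)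
  have b_lim: "b \<longlonglongrightarrow> 1"
    unfolding b_def[abs_def] by real_asymp
  have "AE \<omega> in M. \<forall>m. \<forall>x\<in>{x\<in>\<rat>. 0 < x}. 0 < \<xi> \<omega> \<longrightarrow>
    (\<forall>\<kappa> > (sqrt x + \<xi> \<omega> / sqrt x) / (2 * b m * sqrt (\<xi> \<omega>)). \<forall>\<^sub>F t in at_right 0.
      \<bar>sqrt (Z t \<omega>) - sqrt (f t * \<xi> \<omega>)\<bar> / sqrt (t * ln (ln (1 / t))) \<le> \<kappa>)"
    unfolding AE_all_countable
  proof (intro allI AE_ball_countable')
    show "countable {x\<in>\<rat>. 0 < (x::real)}" by (rule countable_subset[OF _ countable_rat]) auto
  qed (auto intro!: lil_parametrized[OF \<xi> lim b])
  with pos show ?thesis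
  proof eventually_elim
    case (elim \<omega>)
    define W where "W t = \<bar>sqrt (Z t \<omega>) - sqrt (f t * \<xi> \<omega>)\<bar> / sqrt (t * ln (ln (1 / t)))" for t
    have ev: "\<forall>\<^sub>F t in at_right 0. W t \<le> \<kappa>" if \<kappa>: "1 < \<kappa>" for \<kappa>
    proof -
      define c where "c = sqrt \<kappa>"
      have c: "1 < c" "c * c = \<kappa>" using \<kappa> by (auto simp: c_def)
      have "\<forall>\<^sub>F m in sequentially. 1 / c < b m"
        by (rule order_tendstoD(1)[OF b_lim]) (use c in simp)
      then obtain m where m: "1 / c < b m" by (auto simp: eventually_sequentially)
      have "\<xi> \<omega> < c\<^sup>2 * \<xi> \<omega>" using elim(1) c \<kappa> by (simp add: power2_eq_square)
      then obtain x where x: "x \<in> \<rat>" "\<xi> \<omega> < x" "x < c\<^sup>2 * \<xi> \<omega>" using Rats_dense_in_real by blast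
      define s where "s = sqrt (\<xi> \<omega>)"
      have s: "0 < s" "s * s = \<xi> \<omega>" using elim(1) by (auto simp: s_def)
      have y1: "s < sqrt x" using x(2) by (simp add: s_def)
      have "sqrt x < sqrt (c\<^sup>2 * \<xi> \<omega>)" using x(3) by simp
      then have y2: "sqrt x < c * s" using c by (simp add: real_sqrt_mult s_def)
      have "0 < sqrt x" using y1 s(1) by linarith
      then have "\<xi> \<omega> / sqrt x < s"
        unfolding s(2)[symmetric] using y1 s(1) by (subst pos_divide_less_eq) auto
      moreover have "s < c * s" using c s by simp
      ultimately have "sqrt x + \<xi> \<omega> / sqrt x < 2 * (c * s)" using y2 by linarith
      then have "(sqrt x + \<xi> \<omega> / sqrt x) / (2 * b m * s) < 2 * (c * s) / (2 * b m * s)"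
        using b[of m] s by (intro divide_strict_right_mono) auto
      also have "\<dots> = c / b m" using s by simp
      also have "\<dots> < \<kappa>"
        using m c b[of m] by (simp add: divide_less_eq mult.commute flip: c(2))
      finally have "(sqrt x + \<xi> \<omega> / sqrt x) / (2 * b m * sqrt (\<xi> \<omega>)) < \<kappa>" by (simp add: s_def)
      moreover have "0 < x" using x elim(1) by simp
      ultimately show ?thesis using elim x(1) unfolding W_def by blast
    qed
    have "Limsup (at_right 0) (\<lambda>t. ereal (W t)) \<le> ereal 1"
    proof (rule ereal_le_epsilon2)
      fix e :: real assume "0 < e"
      then have "\<forall>\<^sub>F t in at_right 0. ereal (W t) \<le> ereal (1 + e)"
        using ev[of "1 + e"] by simp
      then show "Limsup (at_right 0) (\<lambda>t. ereal (W t)) \<le> ereal 1 + ereal e"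
        by (simp add: Limsup_bounded)
    qed
    then show ?case by (simp add: W_def one_ereal_def)
  qed
qed

end

theorem theorem1p14:
  fixes M :: "'a measure" and \<alpha> \<rho> :: real and f :: "real \<Rightarrow> real"
    and Z :: "real \<Rightarrow> 'a \<Rightarrow> real"
  assumes "prob_space M"
    and "0 < \<alpha>"
    and "\<forall>t>0. 0 < f t"
    and "concave_on {0<..} f"
    and "regularly_varying_at_zero f \<rho>" and "\<rho> < 1"
    and "permanental_process M \<alpha> {0<..} (u_tilde f) Z"
    and "AE \<omega> in M. continuous_on {0<..} (\<lambda>t. Z t \<omega>)"
  shows "(\<exists>\<xi>. gamma_coupling M \<alpha> f Z \<xi>) \<and>
    (\<forall>\<xi>. gamma_coupling M \<alpha> f Z \<xi> \<longrightarrow>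
      (AE \<omega> in M. Limsup (at_right 0)
         (\<lambda>t. ereal (\<bar>sqrt (Z t \<omega>) - sqrt (f t * \<xi> \<omega>)\<bar> / sqrt (t * ln (ln (1 / t))))) \<le> 1))"
proof -
  have pos: "\<And>t. 0 < t \<Longrightarrow> 0 < f t" using assms(3) by blast
  obtain C \<gamma> t0 where C: "0 < C" "0 < \<gamma>" "0 < t0" "\<And>t. 0 < t \<Longrightarrow> t \<le> t0 \<Longrightarrow> t / f t \<le> C * t powr \<gamma>"
    using regularly_varying_ratio_powr_bound[OF assms(4) pos assms(5,6)] by metis
  interpret prob_space M by (rule assms(1))
  interpret permanental_min_plus M \<alpha> f Z C \<gamma> t0
    by unfold_locales (use assms pos C in auto)
  show ?thesis using coupling_exists lil_upper_bound by blast
qed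

end
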